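(* Let $L$ be a line arrangement and $\ell$ be a line of $L$. Let $L'$ be the line arrangement obtained from $L$ by removing $\ell$, and assume that $\ell$ intersects $L'$ in at most two points. If the configuration space $Z^o_{L'}$ of $L'$ is irreducible, then so is the configuration space $Z^o_L$ of $L$.
   Context: Throughout, $d\ge3$ is a fixed integer and $\mathbb{K}$ is an algebraically closed field. Line arrangements. A line arrangement $L=(\mathcal{P},\mathcal{L},\mathcal{I})$ on $[n]=\{1,\dots,n\}$ (or on any finite set) with possibly empty set of zero points $S\subseteq[n]$ consists of a partition $\mathcal{P}$ of $[n]\setminus S$ (whose blocks are called points), a set $\mathcal{L}$ of lines, and an incidence relation $\mathcal{I}\subseteq\mathcal{P}\times\mathcal{L}$, such that each line contains at least three distinct points and any pair of points lies on at most one common line. Elements of $[n]$ are also called points of $L$; $i,j\in[n]\setminus S$ coincide if they belong to the same block. Removing a line. The line arrangement obtained from $L$ by removing $\ell$ has all points of $L$ which do not lie solely on $\ell$, and has all lines of $L$ except $\ell$, with the same incidence structure (incidences are restricted). Configuration space. Let $X=(x_{i,j})$ be a $d\times n$ matrix of variables. For $A\subseteq[d]$, $B\subseteq[n]$ with $|A|=|B|$, $[A|B]$ is the determinant of the submatrix of $X$ with rows $A$ and columns $B$. $V(I)$ denotes the vanishing locus of an ideal $I$ in $\mathbb{K}^{d\times n}$. Let $F(L)\subseteq\mathbb{K}[X]$ be the set consisting of: all variables $x_{i,j}$ with $i\in[d]$, $j\in S$; all $2$-minors $[A|B]$ with $|A|=|B|=2$ and $B\subseteq P$ for some $P\in\mathcal{P}$;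 all $3$-minors $[A|B]$ with $|A|=3$ and $B$ a triple of distinct non-zero points of $L$ lying on a common line; and all $4$-minors $[A|B]$ with $|A|=|B|=4$ such that there are two lines $\ell_1,\ell_2$ of $L$ intersecting at a point of $L$ with every element of $B$ lying in a block incident to $\ell_1$ or $\ell_2$ (there are no $4$-minors if $d=3$). Put $N_L=\langle F(L)\rangle$. A basis of $L$ is a maximal subset $B\subseteq[n]$ of size at most $d$ such that $B\cap S=\emptyset$, no two points in $B$ coincide and no three points in $B$ lie on the same line. For a basis $B$, let $I_B=\langle [A|B]: A\subseteq[d],\ |A|=|B|\rangle$. The configuration space of $L$ is $Z^o_L=V(N_L)\setminus\bigcup_B V(I_B)\subseteq\mathbb{K}^{d\times n}$, the union being over all bases $B$ of $L$, with the Zariski topology. *)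

theory Defs
  imports
    "HOL-Analysis.Abstract_Topology"
    "HOL-Library.Disjoint_Sets"
    "HOL-Library.Poly_Mapping"
    "HOL-Computational_Algebra.Polynomial"
    "Jordan_Normal_Form.Determinant"
begin

section \<open>Line arrangements\<close>

text \<open>
  The blocks of the partition are the points in the geometric sense; lines are abstract objects
  related to blocks by the incidence relation. The ground set is an arbitrary finite subset of a
  linearly ordered type; the order only serves to arrange the columns of a minor.
\<close>

record ('e, 'l) arrangement =
  ground :: "'e set"
  zeros :: "'e set"
  blocks :: "'e set set"
  lines :: "'l set"
  inc :: "('e set \<times> 'l) set"

definition line_arrangement :: "('e, 'l) arrangement \<Rightarrow> bool" where
  "line_arrangement L \<longleftrightarrow>
     finite (ground L) \<and> zeros L \<subseteq> ground L \<and>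
     partition_on (ground L - zeros L) (blocks L) \<and>
     inc L \<subseteq> blocks L \<times> lines L \<and>
     (\<forall>l\<in>lines L. card {P \<in> blocks L. (P, l) \<in> inc L} \<ge> 3) \<and>
     (\<forall>P\<in>blocks L. \<forall>Q\<in>blocks L. P \<noteq> Q \<longrightarrow>
        (\<forall>l\<in>lines L. \<forall>m\<in>lines L.
           (P, l) \<in> inc L \<and> (Q, l) \<in> inc L \<and> (P, m) \<in> inc L \<and> (Q, m) \<in> inc L \<longrightarrow> l = m))"

definition on_line :: "('e, 'l) arrangement \<Rightarrow> 'l \<Rightarrow> 'e set" where
  "on_line L l = \<Union>{P \<in> blocks L. (P, l) \<in> inc L}"

definition coincide :: "('e, 'l) arrangement \<Rightarrow> 'e \<Rightarrow> 'e \<Rightarrow> bool" where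
  "coincide L i j \<longleftrightarrow> (\<exists>P\<in>blocks L. i \<in> P \<and> j \<in> P)"

definition solely_on :: "('e, 'l) arrangement \<Rightarrow> 'e set \<Rightarrow> 'l \<Rightarrow> bool" where
  "solely_on L P l \<longleftrightarrow> (P, l) \<in> inc L \<and> (\<forall>m\<in>lines L. (P, m) \<in> inc L \<longrightarrow> m = l)"

text \<open>Zero points lie on no line, hence they survive the removal of a line.\<close>

definition remove_line :: "('e, 'l) arrangement \<Rightarrow> 'l \<Rightarrow> ('e, 'l) arrangement" where
  "remove_line L l =
     (let keep = {P \<in> blocks L. \<not> solely_on L P l} in
      \<lparr> ground = zeros L \<union> \<Union>keep, zeros = zeros L, blocks = keep, lines = lines L - {l},
        inc = inc L \<inter> keep \<times> (lines L - {l}) \<rparr>)"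

lemma line_arrangement_remove_line:
  assumes L: "line_arrangement L"
  shows "line_arrangement (remove_line L l)"
proof -
  let ?K = "{P \<in> blocks L. \<not> solely_on L P l}"
  let ?L = "remove_line L l"
  have p: "\<Union>(blocks L) = ground L - zeros L" "disjoint (blocks L)" "{} \<notin> blocks L"
    using L by (auto simp: line_arrangement_def partition_on_def)
  have "\<Union>?K \<subseteq> ground L" "zeros L \<subseteq> ground L" "finite (ground L)"
    using L p(1) by (auto simp: line_arrangement_def)
  then have f: "finite (ground ?L)"
    by (auto simp: remove_line_def Let_def intro: finite_subset)
  have "\<Union>?K \<inter> zeros L = {}" using p(1) by blast
  then have "partition_on (ground ?L - zeros ?L) (blocks ?L)"
    using p unfolding partition_on_def disjoint_def
    by (simp add: remove_line_def Let_def) blast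
  moreover have "{P \<in> blocks ?L. (P, m) \<in> inc ?L} = {P \<in> blocks L. (P, m) \<in> inc L}"
    if "m \<in> lines ?L" for m
    using that by (auto simp: remove_line_def solely_on_def Let_def)
  moreover have sub: "lines ?L \<subseteq> lines L" "inc ?L \<subseteq> inc L" "blocks ?L \<subseteq> blocks L"
    by (auto simp: remove_line_def Let_def)
  moreover have "zeros ?L \<subseteq> ground ?L" "inc ?L \<subseteq> blocks ?L \<times> lines ?L"
    by (auto simp: remove_line_def Let_def)
  moreover have "\<forall>P\<in>blocks ?L. \<forall>Q\<in>blocks ?L. P \<noteq> Q \<longrightarrow>
        (\<forall>l\<in>lines ?L. \<forall>m\<in>lines ?L.
           (P, l) \<in> inc ?L \<and> (Q, l) \<in> inc ?L \<and> (P, m) \<in> inc ?L \<and> (Q, m) \<in> inc ?L \<longrightarrow> l = m)"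
  proof (intro ballI impI)
    fix P Q k m
    assume "P \<in> blocks ?L" "Q \<in> blocks ?L" "P \<noteq> Q" "k \<in> lines ?L" "m \<in> lines ?L"
      "(P, k) \<in> inc ?L \<and> (Q, k) \<in> inc ?L \<and> (P, m) \<in> inc ?L \<and> (Q, m) \<in> inc ?L"
    with sub have "P \<in> blocks L" "Q \<in> blocks L" "P \<noteq> Q" "k \<in> lines L" "m \<in> lines L"
      "(P, k) \<in> inc L \<and> (Q, k) \<in> inc L \<and> (P, m) \<in> inc L \<and> (Q, m) \<in> inc L"
      by auto
    then show "k = m"
      using L unfolding line_arrangement_def by blast
  qed
  moreover have "\<forall>m\<in>lines L. card {P \<in> blocks L. (P, m) \<in> inc L} \<ge> 3"
    using L by (simp add: line_arrangement_def)
  ultimately show ?thesis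
    using f unfolding line_arrangement_def by auto
qed

text \<open>Maximality is with respect to inclusion, among the sets of size at most \<open>d\<close>.\<close>

definition independent_points :: "nat \<Rightarrow> ('e, 'l) arrangement \<Rightarrow> 'e set \<Rightarrow> bool" where
  "independent_points d L B \<longleftrightarrow>
     B \<subseteq> ground L \<and> card B \<le> d \<and> B \<inter> zeros L = {} \<and>
     (\<forall>i\<in>B. \<forall>j\<in>B. i \<noteq> j \<longrightarrow> \<not> coincide L i j) \<and>
     \<not> (\<exists>l\<in>lines L. \<exists>T\<subseteq>B. card T = 3 \<and> T \<subseteq> on_line L l)"

definition basis :: "nat \<Rightarrow> ('e, 'l) arrangement \<Rightarrow> 'e set \<Rightarrow> bool" where
  "basis d L B \<longleftrightarrow>
     independent_points d L B \<and> (\<forall>C. independent_points d L C \<and> B \<subseteq> C \<longrightarrow> C = B)"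


section \<open>Polynomials and the Zariski topology\<close>

text \<open>
  Monomials are finitely supported exponent functions, and polynomials are finitely supported
  coefficient functions on monomials, with the convolution product. The variable
  \<open>x\<^bsub>i,j\<^esub>\<close> is indexed by the pair \<open>(i, j)\<close>; the polynomial ring of a matrix of size
  \<open>d \<times> E\<close> consists of the polynomials in which only variables from \<open>{1..d} \<times> E\<close> occur.
\<close>

type_synonym ('v, 'k) mpoly = "('v \<Rightarrow>\<^sub>0 nat) \<Rightarrow>\<^sub>0 'k"

definition Var :: "'v \<Rightarrow> ('v, 'k::comm_ring_1) mpoly" where
  "Var v = Poly_Mapping.single (Poly_Mapping.single v 1) 1"

definition polys :: "'v set \<Rightarrow> ('v, 'k::comm_ring_1) mpoly set" where
  "polys V = {p. \<forall>m\<in>Poly_Mapping.keys p. Poly_Mapping.keys m \<subseteq> V}"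

definition monom_eval :: "('v \<Rightarrow> 'k::comm_ring_1) \<Rightarrow> ('v \<Rightarrow>\<^sub>0 nat) \<Rightarrow> 'k" where
  "monom_eval x m = (\<Prod>v\<in>Poly_Mapping.keys m. x v ^ Poly_Mapping.lookup m v)"

definition poly_eval :: "('v \<Rightarrow> 'k::comm_ring_1) \<Rightarrow> ('v, 'k) mpoly \<Rightarrow> 'k" where
  "poly_eval x p = (\<Sum>m\<in>Poly_Mapping.keys p. Poly_Mapping.lookup p m * monom_eval x m)"

definition ideal_gen :: "'v set \<Rightarrow> ('v, 'k::comm_ring_1) mpoly set \<Rightarrow> ('v, 'k) mpoly set" where
  "ideal_gen V F =
     {\<Sum>f\<in>G. c f * f | G c. finite G \<and> G \<subseteq> F \<and> (\<forall>f\<in>G. c f \<in> polys V)}"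

text \<open>Affine space with coordinates indexed by \<open>V\<close>: functions are normalised outside of \<open>V\<close>.\<close>

definition affine_space :: "'v set \<Rightarrow> ('v \<Rightarrow> 'k) set" where
  "affine_space V = V \<rightarrow>\<^sub>E UNIV"

definition vanishing_locus :: "'v set \<Rightarrow> ('v, 'k::comm_ring_1) mpoly set \<Rightarrow> ('v \<Rightarrow> 'k) set" where
  "vanishing_locus V I = {x \<in> affine_space V. \<forall>p\<in>I. poly_eval x p = 0}"

definition zariski :: "'v set \<Rightarrow> ('v \<Rightarrow> 'k::idom) topology" where
  "zariski V = topology (\<lambda>U. \<exists>I\<subseteq>polys V. U = affine_space V - vanishing_locus V I)"

lemma monom_eval_superset:
  assumes "finite A" "Poly_Mapping.keys m \<subseteq> A"
  shows "monom_eval x m = (\<Prod>v\<in>A. x v ^ Poly_Mapping.lookup m v)"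
  unfolding monom_eval_def using assms
  by (intro prod.mono_neutral_left) (auto simp: in_keys_iff)

lemma monom_eval_add: "monom_eval x (m + n) = monom_eval x m * monom_eval x n"
proof -
  let ?A = "Poly_Mapping.keys m \<union> Poly_Mapping.keys n"
  have "monom_eval x (m + n) = (\<Prod>v\<in>?A. x v ^ Poly_Mapping.lookup (m + n) v)"
    by (intro monom_eval_superset) (auto dest: subsetD[OF keys_add])
  also have "\<dots> = (\<Prod>v\<in>?A. x v ^ Poly_Mapping.lookup m v) * (\<Prod>v\<in>?A. x v ^ Poly_Mapping.lookup n v)"
    by (simp add: lookup_add power_add prod.distrib)
  finally show ?thesis
    by (simp add: monom_eval_superset[of ?A])
qed

lemma poly_eval_superset:
  assumes "finite A" "Poly_Mapping.keys p \<subseteq> A"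
  shows "poly_eval x p = (\<Sum>m\<in>A. Poly_Mapping.lookup p m * monom_eval x m)"
  unfolding poly_eval_def using assms
  by (intro sum.mono_neutral_left) (auto simp: in_keys_iff)

lemma poly_eval_add: "poly_eval x (p + q) = poly_eval x p + poly_eval x q"
proof -
  let ?A = "Poly_Mapping.keys p \<union> Poly_Mapping.keys q"
  have "poly_eval x (p + q) = (\<Sum>m\<in>?A. Poly_Mapping.lookup (p + q) m * monom_eval x m)"
    by (intro poly_eval_superset) (auto dest: subsetD[OF keys_add])
  then show ?thesis
    by (simp add: poly_eval_superset[of ?A] lookup_add distrib_right sum.distrib)
qed

lemma poly_eval_0 [simp]: "poly_eval x 0 = 0"
  by (simp add: poly_eval_def)

lemma poly_eval_sum: "poly_eval x (\<Sum>i\<in>A. p i) = (\<Sum>i\<in>A. poly_eval x (p i))"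
  by (induction A rule: infinite_finite_induct) (auto simp: poly_eval_add)

lemma poly_eval_single: "poly_eval x (Poly_Mapping.single m c) = c * monom_eval x m"
  by (simp add: poly_eval_def)

lemma sum_single_keys:
  "(\<Sum>m\<in>Poly_Mapping.keys p. Poly_Mapping.single m (Poly_Mapping.lookup p m)) = p"
  by (rule poly_mapping_eqI)
    (auto simp: lookup_sum lookup_single when_def in_keys_iff)

lemma poly_eval_mult: "poly_eval x (p * q) = poly_eval x p * poly_eval x q"
proof -
  let ?s = "\<lambda>p m. Poly_Mapping.single m (Poly_Mapping.lookup p m)"
  have "p * q = (\<Sum>m\<in>Poly_Mapping.keys p. ?s p m) * (\<Sum>n\<in>Poly_Mapping.keys q. ?s q n)"
    by (simp only: sum_single_keys)
  also have "\<dots> = (\<Sum>m\<in>Poly_Mapping.keys p. \<Sum>n\<in>Poly_Mapping.keys q.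
      Poly_Mapping.single (m + n) (Poly_Mapping.lookup p m * Poly_Mapping.lookup q n))"
    by (simp add: sum_product mult_single)
  finally have "poly_eval x (p * q) = (\<Sum>m\<in>Poly_Mapping.keys p. \<Sum>n\<in>Poly_Mapping.keys q.
      Poly_Mapping.lookup p m * Poly_Mapping.lookup q n * (monom_eval x m * monom_eval x n))"
    by (simp add: poly_eval_sum poly_eval_single monom_eval_add)
  then show ?thesis
    by (simp add: poly_eval_def sum_product mult_ac)
qed

lemma polys_mult:
  assumes "p \<in> polys V" "q \<in> polys V"
  shows "p * q \<in> polys V"
proof -
  have "Poly_Mapping.keys k \<subseteq> V" if k: "k \<in> Poly_Mapping.keys (p * q)" for k
  proof -
    obtain m n where "m \<in> Poly_Mapping.keys p" "n \<in> Poly_Mapping.keys q" "k = m + n"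
      using keys_mult k by blast
    then show ?thesis
      using assms keys_add[of m n] unfolding polys_def by blast
  qed
  then show ?thesis by (simp add: polys_def)
qed

lemma istopology_zariski:
  "istopology (\<lambda>U. \<exists>I\<subseteq>polys V. U = affine_space V - vanishing_locus V (I :: ('v, 'k::idom) mpoly set))"
  unfolding istopology_def
proof (intro conjI allI impI)
  fix S T :: "('v \<Rightarrow> 'k) set"
  assume "\<exists>I\<subseteq>polys V. S = affine_space V - vanishing_locus V I"
  then obtain I where I: "I \<subseteq> polys V" "S = affine_space V - vanishing_locus V I" by blast
  assume "\<exists>I\<subseteq>polys V. T = affine_space V - vanishing_locus V I"
  then obtain J where J: "J \<subseteq> polys V" "T = affine_space V - vanishing_locus V J" by blast
  let ?M = "{p * q | p q. p \<in> I \<and> q \<in> J}"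
  have "(\<forall>r\<in>?M. poly_eval x r = 0) \<longleftrightarrow>
      (\<forall>p\<in>I. poly_eval x p = 0) \<or> (\<forall>q\<in>J. poly_eval x q = 0)" for x
  proof -
    have "(\<forall>r\<in>?M. poly_eval x r = 0) \<longleftrightarrow> (\<forall>p\<in>I. \<forall>q\<in>J. poly_eval x (p * q) = 0)"
      by blast
    then show ?thesis by (auto simp: poly_eval_mult)
  qed
  then have "S \<inter> T = affine_space V - vanishing_locus V ?M"
    unfolding I(2) J(2) vanishing_locus_def by auto
  moreover have "?M \<subseteq> polys V"
    using I(1) J(1) by (auto intro: polys_mult)
  ultimately show "\<exists>I\<subseteq>polys V. S \<inter> T = affine_space V - vanishing_locus V I" by blast
next
  fix \<K> :: "('v \<Rightarrow> 'k) set set"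
  assume "\<forall>K\<in>\<K>. \<exists>I\<subseteq>polys V. K = affine_space V - vanishing_locus V I"
  then obtain I where I: "\<And>K. K \<in> \<K> \<Longrightarrow> I K \<subseteq> polys V \<and> K = affine_space V - vanishing_locus V (I K)"
    by metis
  have "K = {x \<in> affine_space V. \<exists>p\<in>I K. poly_eval x p \<noteq> 0}" if "K \<in> \<K>" for K
    using I[OF that] by (auto simp: vanishing_locus_def)
  then have "\<Union>\<K> = affine_space V - vanishing_locus V (\<Union>K\<in>\<K>. I K)"
    unfolding vanishing_locus_def by blast
  moreover have "(\<Union>K\<in>\<K>. I K) \<subseteq> polys V" using I by blast
  ultimately show "\<exists>I\<subseteq>polys V. \<Union>\<K> = affine_space V - vanishing_locus V I" by blast
qed

lemma openin_zariski:
  "openin (zariski V) U \<longleftrightarrow> (\<exists>I\<subseteq>polys V. U = affine_space V - vanishing_locus V I)"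
  unfolding zariski_def by (subst topology_inverse'[OF istopology_zariski]) (rule refl)

lemma topspace_zariski [simp]: "topspace (zariski V) = affine_space V"
proof (rule antisym)
  show "topspace (zariski V) \<subseteq> affine_space V"
    using openin_topspace[of "zariski V"] unfolding openin_zariski by blast
  have "vanishing_locus V {1} = {}"
    by (auto simp: vanishing_locus_def poly_eval_single monom_eval_def simp flip: single_one)
  moreover have "{1} \<subseteq> polys V" by (simp add: polys_def)
  ultimately have "openin (zariski V) (affine_space V)"
    unfolding openin_zariski by (metis Diff_empty)
  then show "affine_space V \<subseteq> topspace (zariski V)"
    by (rule openin_subset)
qed

lemma closedin_zariski:
  "closedin (zariski V) C \<longleftrightarrow> (\<exists>I\<subseteq>polys V. C = vanishing_locus V I)"
proof -
  have "vanishing_locus V I \<subseteq> affine_space V" for I :: "('a, 'b) mpoly set"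
    by (auto simp: vanishing_locus_def)
  then show ?thesis
    unfolding closedin_def openin_zariski topspace_zariski
    by (metis Diff_Diff_Int Diff_subset inf.absorb_iff2)
qed

text \<open>
  A space is irreducible if it is not the union of two proper closed subsets. In this convention
  the empty space is irreducible.
\<close>

definition irreducible_space :: "'a topology \<Rightarrow> bool" where
  "irreducible_space X \<longleftrightarrow>
     \<not> (\<exists>C D. closedin X C \<and> closedin X D \<and> C \<noteq> topspace X \<and> D \<noteq> topspace X \<and>
             topspace X = C \<union> D)"


section \<open>The configuration space\<close>

text \<open>
  \<open>minor A B\<close> is the determinant of the submatrix of the generic matrix with rows \<open>A\<close> and
  columns \<open>B\<close>, taken in increasing order.
\<close>

definition minor :: "nat set \<Rightarrow> 'e::linorder set \<Rightarrow> (nat \<times> 'e, 'k::comm_ring_1) mpoly" where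
  "minor A B = det (mat (card A) (card B)
     (\<lambda>(r, c). Var (sorted_list_of_set A ! r, sorted_list_of_set B ! c)))"

definition entries :: "nat \<Rightarrow> ('e, 'l) arrangement \<Rightarrow> (nat \<times> 'e) set" where
  "entries d L = {1..d} \<times> ground L"

definition arr_polys ::
    "nat \<Rightarrow> ('e::linorder, 'l) arrangement \<Rightarrow> (nat \<times> 'e, 'k::comm_ring_1) mpoly set" where
  "arr_polys d L =
     {Var (i, j) | i j. i \<in> {1..d} \<and> j \<in> zeros L} \<union>
     {minor A B | A B. A \<subseteq> {1..d} \<and> card A = 2 \<and> card B = 2 \<and> (\<exists>P\<in>blocks L. B \<subseteq> P)} \<union>
     {minor A B | A B. A \<subseteq> {1..d} \<and> card A = 3 \<and> card B = 3 \<and> (\<exists>l\<in>lines L. B \<subseteq> on_line L l)} \<union>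
     {minor A B | A B. A \<subseteq> {1..d} \<and> card A = 4 \<and> card B = 4 \<and>
        (\<exists>l\<in>lines L. \<exists>m\<in>lines L. l \<noteq> m \<and>
           (\<exists>P\<in>blocks L. (P, l) \<in> inc L \<and> (P, m) \<in> inc L) \<and> B \<subseteq> on_line L l \<union> on_line L m)}"

definition arr_ideal ::
    "nat \<Rightarrow> ('e::linorder, 'l) arrangement \<Rightarrow> (nat \<times> 'e, 'k::comm_ring_1) mpoly set" where
  "arr_ideal d L = ideal_gen (entries d L) (arr_polys d L)"

definition minors_ideal ::
    "nat \<Rightarrow> ('e::linorder, 'l) arrangement \<Rightarrow> 'e set \<Rightarrow> (nat \<times> 'e, 'k::comm_ring_1) mpoly set" where
  "minors_ideal d L B =
     ideal_gen (entries d L) {minor A B | A. A \<subseteq> {1..d} \<and> card A = card B}"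

definition config_set ::
    "nat \<Rightarrow> ('e::linorder, 'l) arrangement \<Rightarrow> (nat \<times> 'e \<Rightarrow> 'k::idom) set" where
  "config_set d L =
     vanishing_locus (entries d L) (arr_ideal d L) -
     (\<Union>B\<in>{B. basis d L B}. vanishing_locus (entries d L) (minors_ideal d L B))"

definition config_space ::
    "nat \<Rightarrow> ('e::linorder, 'l) arrangement \<Rightarrow> (nat \<times> 'e \<Rightarrow> 'k::idom) topology" where
  "config_space d L = subtopology (zariski (entries d L)) (config_set d L)"

end

theory Submission
  imports Defs
begin

text \<open>
  Write \<open>L'\<close> for the arrangement without the line \<open>l\<close>. Since \<open>l\<close> meets \<open>L'\<close> in at most two points,
  one can choose two points \<open>P1, P2\<close> on \<open>l\<close>, with representatives \<open>e1, e2\<close>, among which are all points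
  of \<open>l\<close> that survive in \<open>L'\<close>. In a configuration of \<open>L\<close> the columns on \<open>l\<close> lie in the plane spanned
  by the columns of \<open>e1\<close> and \<open>e2\<close>, hence the configuration is recovered from its restriction to \<open>L'\<close>
  by free parameters: a column for each \<open>ek\<close> not in \<open>L'\<close>, two coefficients for each removed block, and
  a scalar for each element of a removed block. Conversely, every choice of parameters
  satisfies the equations of \<open>L\<close>, so the configuration space of \<open>L\<close> is the
  intersection of an open set with the image of (affine space) \<open>\<times>\<close> (configuration space of \<open>L'\<close>)
  under a polynomial map. The product stays irreducible: if a product \<open>F G\<close> vanishes on it, then on
  each fibre one factor vanishes (restrict to a line in the parameter space), and the two sets of
  base points on whose fibre \<open>F\<close>, respectively \<open>G\<close>, vanishes are closed.
\<close>

section \<open>Polynomial functions\<close>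

text \<open>Agreement is demanded at every function \<open>x\<close>, not only at normalised points
  of \<open>affine_space V\<close>, so that polynomial functions compose without domain
  conditions.\<close>

definition poly_fun :: "'v set \<Rightarrow> (('v \<Rightarrow> 'k::comm_ring_1) \<Rightarrow> 'k) \<Rightarrow> bool" where
  "poly_fun V h \<longleftrightarrow> (\<exists>p\<in>polys V. \<forall>x. h x = poly_eval x p)"

text \<open>Serves for restrictions to a line in the parameter space, where the zero-product
  property of univariate polynomials becomes available.\<close>

definition upoly_fun :: "('k::comm_ring_1 \<Rightarrow> 'k) \<Rightarrow> bool" where
  "upoly_fun h \<longleftrightarrow> (\<exists>p. \<forall>u. h u = poly p u)"

lemma poly_eval_Var: "poly_eval x (Var v) = x v"
  by (simp add: Var_def poly_eval_single monom_eval_def)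

lemma poly_fun_const: "poly_fun V (\<lambda>_. c)"
  unfolding poly_fun_def
  by (rule bexI[of _ "Poly_Mapping.single 0 c"])
    (auto simp: poly_eval_single monom_eval_def polys_def)

lemma poly_fun_var: "v \<in> V \<Longrightarrow> poly_fun V (\<lambda>x. x v)"
  unfolding poly_fun_def
  by (rule bexI[of _ "Var v"]) (auto simp: poly_eval_Var, auto simp: polys_def Var_def)

lemma poly_fun_add: "poly_fun V f \<Longrightarrow> poly_fun V g \<Longrightarrow> poly_fun V (\<lambda>x. f x + g x)"
proof -
  have "p + q \<in> polys V" if "p \<in> polys V" "q \<in> polys V" for p q :: "('a, 'b) mpoly"
    using that keys_add[of p q] unfolding polys_def by blast
  moreover assume "poly_fun V f" "poly_fun V g"
  ultimately show "poly_fun V (\<lambda>x. f x + g x)"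
    unfolding poly_fun_def by (auto simp flip: poly_eval_add)
qed

lemma poly_fun_mult: "poly_fun V f \<Longrightarrow> poly_fun V g \<Longrightarrow> poly_fun V (\<lambda>x. f x * g x)"
  unfolding poly_fun_def by (auto simp flip: poly_eval_mult intro: polys_mult)

lemma upoly_fun_const: "upoly_fun (\<lambda>_. c)"
  unfolding upoly_fun_def by (rule exI[of _ "[:c:]"]) simp

lemma upoly_fun_affine: "upoly_fun (\<lambda>u. a + u * b)"
  unfolding upoly_fun_def by (rule exI[of _ "[:a, b:]"]) simp

lemma upoly_fun_add: "upoly_fun f \<Longrightarrow> upoly_fun g \<Longrightarrow> upoly_fun (\<lambda>x. f x + g x)"
  unfolding upoly_fun_def by (auto simp flip: poly_add)

lemma upoly_fun_mult: "upoly_fun f \<Longrightarrow> upoly_fun g \<Longrightarrow> upoly_fun (\<lambda>x. f x * g x)"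
  unfolding upoly_fun_def by (auto simp flip: poly_mult)

text \<open>An evaluation is assembled from constants, sums and products. Abstracting over
  \<open>R\<close> yields the substitution lemmas for \<open>poly_fun\<close> and
  \<open>upoly_fun\<close> by one argument.\<close>

lemma poly_eval_closed:
  fixes R :: "('a \<Rightarrow> 'k::comm_ring_1) \<Rightarrow> bool"
  assumes const: "\<And>c. R (\<lambda>_. c)"
    and add: "\<And>f g. R f \<Longrightarrow> R g \<Longrightarrow> R (\<lambda>a. f a + g a)"
    and mult: "\<And>f g. R f \<Longrightarrow> R g \<Longrightarrow> R (\<lambda>a. f a * g a)"
    and g: "\<And>v. R (\<lambda>a. g a v)"
  shows "R (\<lambda>a. poly_eval (g a) p)"
proof -
  have power: "R (\<lambda>a. f a ^ n)" if "R f" for f n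
    by (induction n) (simp_all add: const mult that)
  have prod: "R (\<lambda>a. \<Prod>i\<in>I. f i a)" if "\<And>i. R (f i)" for f and I :: "'b set"
    by (induction I rule: infinite_finite_induct) (simp_all add: const mult that)
  have sum: "R (\<lambda>a. \<Sum>i\<in>I. f i a)" if "\<And>i. R (f i)" for f and I :: "('b \<Rightarrow>\<^sub>0 nat) set"
    by (induction I rule: infinite_finite_induct) (simp_all add: const add that)
  show ?thesis
    unfolding poly_eval_def monom_eval_def by (intro sum mult const prod power g)
qed

lemma poly_fun_poly_eval:
  "(\<And>v. poly_fun V (\<lambda>z. g z v)) \<Longrightarrow> poly_fun V (\<lambda>z. poly_eval (g z) p)"
  by (rule poly_eval_closed[of "poly_fun V"]) (auto intro: poly_fun_const poly_fun_add poly_fun_mult)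

lemma upoly_fun_poly_eval:
  "(\<And>v. upoly_fun (\<lambda>z. g z v)) \<Longrightarrow> upoly_fun (\<lambda>z. poly_eval (g z) p)"
  by (rule poly_eval_closed[of upoly_fun]) (auto intro: upoly_fun_const upoly_fun_add upoly_fun_mult)

text \<open>For nonconstant \<open>p\<close>, the polynomial \<open>p + 1\<close> is nonconstant as
  well and has a root; there \<open>p\<close> takes the value -1 instead of 0.\<close>

lemma vanishing_poly_eq_0:
  fixes p :: "'k::alg_closed_field poly"
  assumes "\<And>u. poly p u = 0"
  shows "p = 0"
proof (rule ccontr)
  assume "p \<noteq> 0"
  show False
  proof (cases "degree p = 0")
    case True
    then show False using assms[of 0] \<open>p \<noteq> 0\<close> by (auto elim: degree_eq_zeroE)
  next
    case False
    then have "degree (p + 1) > 0" by (simp add: degree_add_eq_left)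
    then obtain u where "poly (p + 1) u = 0" using alg_closed_imp_poly_has_root by blast
    then show False using assms by simp
  qed
qed


section \<open>Irreducibility of parametrised sets\<close>

text \<open>Closed subsets of a subspace are traces of vanishing loci. In this form irreducibility
  can be used and proved by evaluating polynomials.\<close>

lemma irreducible_subspace_iff:
  fixes V :: "'v set" and Z :: "('v \<Rightarrow> 'k::idom) set"
  assumes Z: "Z \<subseteq> affine_space V"
  shows "irreducible_space (subtopology (zariski V) Z) \<longleftrightarrow>
    (\<forall>I J. I \<subseteq> polys V \<longrightarrow> J \<subseteq> polys V \<longrightarrow> Z \<subseteq> vanishing_locus V I \<union> vanishing_locus V J \<longrightarrow>
       Z \<subseteq> vanishing_locus V I \<or> Z \<subseteq> vanishing_locus V J)"
proof -
  have top: "topspace (subtopology (zariski V) Z) = Z"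
    using Z by (auto simp: topspace_subtopology)
  have cl: "closedin (subtopology (zariski V) Z) C \<longleftrightarrow> (\<exists>I\<subseteq>polys V. C = vanishing_locus V I \<inter> Z)" for C
    unfolding closedin_subtopology closedin_zariski by blast
  show ?thesis
    unfolding irreducible_space_def top cl
  proof (intro iffI allI impI notI)
    fix I J :: "('v, 'k) mpoly set"
    assume irr: "\<not> (\<exists>C D. (\<exists>I\<subseteq>polys V. C = vanishing_locus V I \<inter> Z) \<and>
              (\<exists>I\<subseteq>polys V. D = vanishing_locus V I \<inter> Z) \<and> C \<noteq> Z \<and> D \<noteq> Z \<and> Z = C \<union> D)"
      and IJ: "I \<subseteq> polys V" "J \<subseteq> polys V" "Z \<subseteq> vanishing_locus V I \<union> vanishing_locus V J"
    have "vanishing_locus V I \<inter> Z = Z \<or> vanishing_locus V J \<inter> Z = Z"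
    proof (rule ccontr)
      assume "\<not> ?thesis"
      moreover have "Z = vanishing_locus V I \<inter> Z \<union> vanishing_locus V J \<inter> Z" using IJ(3) by blast
      ultimately show False using irr IJ(1,2) by metis
    qed
    then show "Z \<subseteq> vanishing_locus V I \<or> Z \<subseteq> vanishing_locus V J" by blast
  next
    assume *: "\<forall>I J. I \<subseteq> polys V \<longrightarrow> J \<subseteq> polys V \<longrightarrow> Z \<subseteq> vanishing_locus V I \<union> vanishing_locus V J \<longrightarrow>
       Z \<subseteq> vanishing_locus V I \<or> Z \<subseteq> vanishing_locus V J"
      and "\<exists>C D. (\<exists>I\<subseteq>polys V. C = vanishing_locus V I \<inter> Z) \<and>
              (\<exists>I\<subseteq>polys V. D = vanishing_locus V I \<inter> Z) \<and> C \<noteq> Z \<and> D \<noteq> Z \<and> Z = C \<union> D"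
    then obtain I J where "I \<subseteq> polys V" "J \<subseteq> polys V" "vanishing_locus V I \<inter> Z \<noteq> Z"
      "vanishing_locus V J \<inter> Z \<noteq> Z" "Z = vanishing_locus V I \<inter> Z \<union> vanishing_locus V J \<inter> Z"
      by blast
    with *[rule_format, of I J] show False by blast
  qed
qed

text \<open>\<open>poly\<close> asks for polynomial dependence on the base point for each fixed
  parameter, \<open>upoly\<close> for polynomial dependence along each line of parameters over a
  fixed base point; these are the two ways in which a polynomial on the image gets restricted.
  \<open>into\<close> says that \<open>Z\<close> is open in the image of \<open>\<phi>\<close>, the
  non-vanishing of \<open>h\<close> cutting out a neighbourhood of \<open>x\<close>.\<close>

lemma irreducible_parametrised:
  fixes \<phi> :: "('p \<Rightarrow> 'k::alg_closed_field) \<Rightarrow> ('w \<Rightarrow> 'k) \<Rightarrow> 'v \<Rightarrow> 'k"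
  assumes irr: "irreducible_space (subtopology (zariski V') Z')"
    and Z': "Z' \<subseteq> affine_space V'" and Z: "Z \<subseteq> affine_space V"
    and poly: "\<And>t v. poly_fun V' (\<lambda>z. \<phi> t z v)"
    and upoly: "\<And>s t z v. upoly_fun (\<lambda>u. \<phi> (\<lambda>p. s p + u * (t p - s p)) z v)"
    and onto: "\<And>x. x \<in> Z \<Longrightarrow> \<exists>t. \<exists>z\<in>Z'. x = \<phi> t z"
    and into: "\<And>x. x \<in> Z \<Longrightarrow>
      \<exists>h. poly_eval x h \<noteq> 0 \<and> (\<forall>t. \<forall>z\<in>Z'. poly_eval (\<phi> t z) h \<noteq> 0 \<longrightarrow> \<phi> t z \<in> Z)"
  shows "irreducible_space (subtopology (zariski V) Z)"
  unfolding irreducible_subspace_iff[OF Z]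
proof (intro allI impI, rule ccontr)
  fix I J :: "('v, 'k) mpoly set"
  assume IJ: "Z \<subseteq> vanishing_locus V I \<union> vanishing_locus V J"
    and "\<not> (Z \<subseteq> vanishing_locus V I \<or> Z \<subseteq> vanishing_locus V J)"
  then obtain x y where x: "x \<in> Z" "x \<notin> vanishing_locus V I" and y: "y \<in> Z" "y \<notin> vanishing_locus V J"
    by blast
  obtain f where f: "f \<in> I" "poly_eval x f \<noteq> 0"
    using x Z unfolding vanishing_locus_def by blast
  obtain g where g: "g \<in> J" "poly_eval y g \<noteq> 0"
    using y Z unfolding vanishing_locus_def by blast
  obtain hx where hx: "poly_eval x hx \<noteq> 0"
    "\<And>t z. z \<in> Z' \<Longrightarrow> poly_eval (\<phi> t z) hx \<noteq> 0 \<Longrightarrow> \<phi> t z \<in> Z"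
    using into[OF x(1)] by blast
  obtain hy where hy: "poly_eval y hy \<noteq> 0"
    using into[OF y(1)] by blast
  \<comment> \<open>Where \<open>hx\<close> does not vanish, the image point lies in
    \<open>Z\<close> and hence in one of the two loci. So the product of \<open>F\<close> and
    \<open>G\<close> vanishes on the whole image, while \<open>F\<close> stays nonzero at
    \<open>x\<close> and \<open>G\<close> at \<open>y\<close>.\<close>
  define F where "F = f * hx"
  define G where "G = g * hy"
  have FG: "poly_eval (\<phi> t z) F = 0 \<or> poly_eval (\<phi> t z) G = 0" if "z \<in> Z'" for t z
  proof (rule ccontr)
    assume "\<not> ?thesis"
    then have n: "poly_eval (\<phi> t z) f \<noteq> 0" "poly_eval (\<phi> t z) g \<noteq> 0" "poly_eval (\<phi> t z) hx \<noteq> 0"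
      by (auto simp: F_def G_def poly_eval_mult)
    then have "\<phi> t z \<in> Z" using hx(2) that by blast
    then show False using IJ n f(1) g(1) unfolding vanishing_locus_def by blast
  qed
  have fibre: "(\<forall>t. poly_eval (\<phi> t z) F = 0) \<or> (\<forall>t. poly_eval (\<phi> t z) G = 0)" if z: "z \<in> Z'" for z
  proof (rule ccontr)
    assume "\<not> ?thesis"
    then obtain s t where st: "poly_eval (\<phi> s z) F \<noteq> 0" "poly_eval (\<phi> t z) G \<noteq> 0" by blast
    \<comment> \<open>The line from \<open>s\<close> (at \<open>u = 0\<close>) to \<open>t\<close>
      (at \<open>u = 1\<close>). Along it both polynomials are univariate with product zero, so one
      of them is identically zero, against its value at the corresponding end.\<close>
    let ?c = "\<lambda>u. \<phi> (\<lambda>p. s p + u * (t p - s p)) z"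
    have c: "upoly_fun (\<lambda>u. poly_eval (?c u) H)" for H
      by (rule upoly_fun_poly_eval) (rule upoly)
    obtain p where p: "\<And>u. poly_eval (?c u) F = poly p u"
      using c[of F] unfolding upoly_fun_def by blast
    obtain q where q: "\<And>u. poly_eval (?c u) G = poly q u"
      using c[of G] unfolding upoly_fun_def by blast
    have "poly (p * q) u = 0" for u
      using FG[OF z] by (simp flip: p q)
    then have "p * q = 0" by (rule vanishing_poly_eq_0)
    then have "p = 0 \<or> q = 0" by simp
    then show False using st p[of 0] q[of 1] by auto
  qed
  \<comment> \<open>Collecting the polynomials of all \<open>t\<close> turns vanishing on a whole
    fibre into membership in one vanishing locus, which is a closed condition on the base
    point.\<close>
  define pull where "pull F = {p \<in> polys V'. \<exists>t. \<forall>z. poly_eval z p = poly_eval (\<phi> t z) F}"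
    for F :: "('v, 'k) mpoly"
  have pull: "z \<in> vanishing_locus V' (pull F) \<longleftrightarrow> (\<forall>t. poly_eval (\<phi> t z) F = 0)"
    if "z \<in> Z'" for z F
  proof -
    have "\<exists>p\<in>pull F. \<forall>z. poly_eval z p = poly_eval (\<phi> t z) F" for t
    proof -
      have "poly_fun V' (\<lambda>z. poly_eval (\<phi> t z) F)"
        by (rule poly_fun_poly_eval) (rule poly)
      then obtain p where p: "p \<in> polys V'" "\<And>z. poly_eval z p = poly_eval (\<phi> t z) F"
        unfolding poly_fun_def by metis
      then have "p \<in> pull F" unfolding pull_def by blast
      with p(2) show ?thesis by blast
    qed
    moreover have "\<exists>t. poly_eval z p = poly_eval (\<phi> t z) F" if "p \<in> pull F" for p
      using that unfolding pull_def by blast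
    moreover have "z \<in> affine_space V'" using \<open>z \<in> Z'\<close> Z' by blast
    ultimately show ?thesis
      unfolding vanishing_locus_def mem_Collect_eq by metis
  qed
  have "Z' \<subseteq> vanishing_locus V' (pull F) \<union> vanishing_locus V' (pull G)"
    using fibre pull by blast
  moreover have "pull H \<subseteq> polys V'" for H by (auto simp: pull_def)
  ultimately have "Z' \<subseteq> vanishing_locus V' (pull F) \<or> Z' \<subseteq> vanishing_locus V' (pull G)"
    using irr unfolding irreducible_subspace_iff[OF Z'] by blast
  \<comment> \<open>Each alternative is refuted by one of the two points: \<open>F\<close> is
    nonzero on the fibre over \<open>x'\<close>, and \<open>G\<close> on the fibre over
    \<open>y'\<close>.\<close>
  moreover obtain s x' where "x' \<in> Z'" "x = \<phi> s x'" using onto[OF x(1)] by blast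
  moreover have "poly_eval x F \<noteq> 0" using f hx by (simp add: F_def poly_eval_mult)
  moreover obtain t y' where "y' \<in> Z'" "y = \<phi> t y'" using onto[OF y(1)] by blast
  moreover have "poly_eval y G \<noteq> 0" using g hy by (simp add: G_def poly_eval_mult)
  ultimately show False using pull by blast
qed


section \<open>Minors and linear dependence\<close>

text \<open>A minor of scalars with rows and columns in a prescribed order, whereas
  \<open>minor\<close> always takes them in increasing order; explicit computations need convenient
  orders.\<close>

definition list_minor :: "('a \<times> 'b \<Rightarrow> 'k::comm_ring_1) \<Rightarrow> 'a list \<Rightarrow> 'b list \<Rightarrow> 'k" where
  "list_minor x rs cs = det (mat (length rs) (length rs) (\<lambda>(i, j). x (rs ! i, cs ! j)))"

lemma poly_eval_1 [simp]: "poly_eval x 1 = 1"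
  by (simp add: poly_eval_single monom_eval_def flip: single_one)

lemma comm_ring_hom_poly_eval: "comm_ring_hom (poly_eval (x :: 'v \<Rightarrow> 'k::comm_ring_1))"
  by unfold_locales (auto simp: poly_eval_add poly_eval_mult)

text \<open>Evaluation is a ring homomorphism and therefore commutes with the determinant.\<close>

lemma poly_eval_minor:
  assumes "card A = card B"
  shows "poly_eval x (minor A B) = list_minor x (sorted_list_of_set A) (sorted_list_of_set B)"
proof -
  interpret comm_ring_hom "poly_eval x" by (rule comm_ring_hom_poly_eval)
  show ?thesis
    unfolding minor_def list_minor_def assms hom_det[symmetric]
    by (rule arg_cong[of _ _ det], rule eq_matI) (auto simp: poly_eval_Var assms)
qed

text \<open>Reordering changes a determinant only by a sign. The equations and the bases merely ask
  whether minors vanish, so the sign is not tracked.\<close>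

lemma list_minor_permute_rows:
  assumes "mset rs = mset rs'" "length cs = length rs"
  shows "list_minor x rs cs = 0 \<longleftrightarrow> list_minor (x :: 'a \<times> 'b \<Rightarrow> 'k::idom) rs' cs = 0"
proof -
  obtain p where p: "p permutes {..<length rs'}" "permute_list p rs' = rs"
    using mset_eq_permutation[OF assms(1)] by blast
  have len: "length rs = length rs'" using assms(1) by (rule mset_eq_length)
  let ?n = "length rs'"
  let ?M = "mat ?n ?n (\<lambda>(i, j). x (rs' ! i, cs ! j))"
  have p': "p permutes {0..<?n}" using p(1) by (simp add: lessThan_atLeast0)
  have "mat ?n ?n (\<lambda>(i, j). x (rs ! i, cs ! j)) = mat ?n ?n (\<lambda>(i, j). ?M $$ (p i, j))"
  proof (rule eq_matI)
    fix i j assume "i < dim_row (mat ?n ?n (\<lambda>(i, j). ?M $$ (p i, j)))"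
      and "j < dim_col (mat ?n ?n (\<lambda>(i, j). ?M $$ (p i, j)))"
    then have ij: "i < ?n" "j < ?n" by auto
    then have "p i < ?n" using permutes_in_image[OF p(1), of i] by simp
    moreover have "rs ! i = rs' ! p i"
      using permute_list_nth[OF p(1) ij(1)] p(2) by simp
    ultimately show "mat ?n ?n (\<lambda>(i, j). x (rs ! i, cs ! j)) $$ (i, j) =
        mat ?n ?n (\<lambda>(i, j). ?M $$ (p i, j)) $$ (i, j)"
      using ij by simp
  qed simp_all
  then have "list_minor x rs cs = signof p * list_minor x rs' cs"
    unfolding list_minor_def len using det_permute_rows[OF _ p', of ?M] by simp
  then show ?thesis by (simp add: sign_def)
qed

lemma list_minor_transpose:
  assumes "length cs = length rs"
  shows "list_minor x rs cs = list_minor (\<lambda>(c, r). x (r, c)) cs rs"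
proof -
  let ?M = "mat (length rs) (length rs) (\<lambda>(i, j). x (rs ! i, cs ! j))"
  have "transpose_mat ?M = mat (length rs) (length rs) (\<lambda>(i, j). x (rs ! j, cs ! i))"
    by (rule eq_matI) auto
  then show ?thesis
    unfolding list_minor_def using det_transpose[of ?M "length rs"] assms by simp
qed

lemma list_minor_permute_cols:
  assumes "mset cs = mset cs'" "length cs = length rs"
  shows "list_minor x rs cs = 0 \<longleftrightarrow> list_minor (x :: 'a \<times> 'b \<Rightarrow> 'k::idom) rs cs' = 0"
proof -
  have "length cs' = length rs" using assms by (metis mset_eq_length)
  then show ?thesis
    using list_minor_permute_rows[of cs cs' rs "\<lambda>(c, r). x (r, c)"] assms
    by (simp add: list_minor_transpose[of cs rs] list_minor_transpose[of cs' rs])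
qed

lemma poly_eval_minor_eq_0_iff:
  fixes x :: "nat \<times> 'e::linorder \<Rightarrow> 'k::idom"
  assumes "distinct rs" "distinct cs" "length rs = length cs"
  shows "poly_eval x (minor (set rs) (set cs)) = 0 \<longleftrightarrow> list_minor x rs cs = 0"
proof -
  let ?rs = "sorted_list_of_set (set rs)" and ?cs = "sorted_list_of_set (set cs)"
  have r: "mset ?rs = mset rs" using assms(1) by (metis mset_set_set mset_sorted_list_of_multiset sorted_list_of_mset_set)
  have c: "mset ?cs = mset cs" using assms(2) by (metis mset_set_set mset_sorted_list_of_multiset sorted_list_of_mset_set)
  have "card (set rs) = card (set cs)" using assms by (simp add: distinct_card)
  then have "poly_eval x (minor (set rs) (set cs)) = list_minor x ?rs ?cs"
    by (rule poly_eval_minor)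
  also have "\<dots> = 0 \<longleftrightarrow> list_minor x rs ?cs = 0"
    using mset_eq_length[OF r] mset_eq_length[OF c] assms(3) by (intro list_minor_permute_rows r) simp
  also have "\<dots> \<longleftrightarrow> list_minor x rs cs = 0"
    using mset_eq_length[OF c] assms(3) by (intro list_minor_permute_cols c) simp
  finally show ?thesis .
qed

lemma list_minor_Nil [simp]: "list_minor x [] cs = 1"
  by (simp add: list_minor_def)

section \<open>Laplace expansion and smaller minors\<close>

lemma list_minor_Cons:
  assumes "rs \<noteq> []"
  shows "list_minor x rs (c # cs) =
    (\<Sum>i<length rs. (-1) ^ i * x (rs ! i, c) * list_minor x (take i rs @ drop (Suc i) rs) cs)"
proof -
  let ?n = "length rs"
  let ?M = "mat ?n ?n (\<lambda>(i, j). x (rs ! i, (c # cs) ! j))"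
  have n: "0 < ?n" using assms by simp
  have "det (mat_delete ?M i 0) = list_minor x (take i rs @ drop (Suc i) rs) cs" if "i < ?n" for i
  proof -
    have "mat_delete ?M i 0 = mat (?n - 1) (?n - 1) (\<lambda>(k, j). x ((take i rs @ drop (Suc i) rs) ! k, cs ! j))"
      unfolding mat_delete_def using that
      by (intro eq_matI) (auto simp: nth_append min_def)
    moreover have "length (take i rs @ drop (Suc i) rs) = ?n - 1" using that by simp
    ultimately show ?thesis unfolding list_minor_def by (simp only:)
  qed
  then show ?thesis
    unfolding list_minor_def[of x rs] using laplace_expansion_column[of ?M ?n 0] n
    by (auto simp: cofactor_def mult_ac intro!: sum.cong)
qed

lemma list_minor_2: "list_minor x [r, s] [a, b] = x (r, a) * x (s, b) - x (s, a) * x (r, b)"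
  by (simp add: list_minor_Cons)

lemma list_minor_3: "list_minor x [r, s, t] [a, b, c] =
   x (r, a) * list_minor x [s, t] [b, c] - x (s, a) * list_minor x [r, t] [b, c] + x (t, a) * list_minor x [r, s] [b, c]"
  by (simp add: list_minor_Cons[of "[r, s, t]"] numeral_3_eq_3)

text \<open>Expand along the column \<open>b\<close>: if every complementary minor vanished, so
  would the determinant.\<close>

lemma minor_delete:
  fixes x :: "nat \<times> 'e::linorder \<Rightarrow> 'k::idom"
  assumes "poly_eval x (minor A B) \<noteq> 0" "card A = card B" "finite B" "b \<in> B"
  shows "\<exists>a\<in>A. poly_eval x (minor (A - {a}) (B - {b})) \<noteq> 0"
proof -
  define rs where "rs = sorted_list_of_set A"
  \<comment> \<open>The column \<open>b\<close> is put in front of this list, in the position along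
    which \<open>list_minor_Cons\<close> expands.\<close>
  define cs where "cs = sorted_list_of_set (B - {b})"
  have cB: "card B > 0" using assms(3,4) card_gt_0_iff by blast
  then have fA: "finite A" using assms(2) by (metis card.infinite less_irrefl)
  have rs: "set rs = A" "distinct rs" "length rs = card A"
    using fA by (simp_all add: rs_def)
  have cs: "set (b # cs) = B" "set cs = B - {b}" "distinct (b # cs)" "length (b # cs) = card B"
    using assms(3,4) cB by (auto simp: cs_def)
  have ne: "rs \<noteq> []" using rs assms(2) cB by auto
  have "list_minor x rs (b # cs) \<noteq> 0"
    using poly_eval_minor_eq_0_iff[OF rs(2) cs(3), of x] rs cs assms(1,2) by metis
  then obtain i where i: "i < length rs" "list_minor x (take i rs @ drop (Suc i) rs) cs \<noteq> 0"
    unfolding list_minor_Cons[OF ne] by (metis (no_types, lifting) lessThan_iff mult_zero_right sum.not_neutral_contains_not_neutral)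
  let ?rs = "take i rs @ drop (Suc i) rs"
  have split: "rs = take i rs @ rs ! i # drop (Suc i) rs" using i(1) by (rule id_take_nth_drop)
  have d: "distinct (take i rs @ rs ! i # drop (Suc i) rs)" using rs(2) split by simp
  have s: "set (take i rs @ rs ! i # drop (Suc i) rs) = A" using rs(1) split by simp
  have "set ?rs = A - {rs ! i}" using d s[symmetric] by auto
  moreover have "distinct ?rs" using d by auto
  moreover have "length ?rs = length cs" using i(1) rs(3) cs(4) assms(2) by simp
  ultimately have "poly_eval x (minor (A - {rs ! i}) (B - {b})) \<noteq> 0"
    using poly_eval_minor_eq_0_iff[of ?rs cs x] i(2) cs(2,3) by (metis distinct.simps(2))
  moreover have "rs ! i \<in> A" using i(1) rs(1) by auto
  ultimately show ?thesis by blast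
qed

text \<open>Makes non-degeneracy on a basis pass to its subsets: the surplus columns are deleted one
  at a time.\<close>

lemma minor_subset:
  fixes x :: "nat \<times> 'e::linorder \<Rightarrow> 'k::idom"
  assumes "finite B" "B' \<subseteq> B" "card A = card B" "poly_eval x (minor A B) \<noteq> 0"
  shows "\<exists>A'\<subseteq>A. card A' = card B' \<and> poly_eval x (minor A' B') \<noteq> 0"
  using assms
proof (induction "card (B - B')" arbitrary: A B)
  case 0
  then have "B' = B" by auto
  then show ?case using 0 by blast
next
  case (Suc n)
  then obtain b where b: "b \<in> B" "b \<notin> B'" by (metis Diff_eq_empty_iff card.empty nat.distinct(1) subsetI)
  obtain a where a: "a \<in> A" "poly_eval x (minor (A - {a}) (B - {b})) \<noteq> 0"
    using minor_delete[OF Suc.prems(4,3,1) b(1)] by blast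
  have "B - {b} - B' = B - B' - {b}" by blast
  then have "n = card (B - {b} - B')" using Suc.hyps(2) b by simp
  moreover have "card (A - {a}) = card (B - {b})" using Suc.prems(3) a(1) b(1) by simp
  ultimately have "\<exists>A'\<subseteq>A - {a}. card A' = card B' \<and> poly_eval x (minor A' B') \<noteq> 0"
    using Suc.hyps(1)[of "B - {b}" "A - {a}"] Suc.prems(1,2) a(2) b(2) by blast
  then show ?case by blast
qed

section \<open>Linear spans of columns and vanishing minors\<close>

definition spanned :: "nat \<Rightarrow> (nat \<Rightarrow> 'k::comm_ring_1) list \<Rightarrow> (nat \<Rightarrow> 'k) \<Rightarrow> bool" where
  "spanned d us v \<longleftrightarrow> (\<exists>f. \<forall>r\<in>{1..d}. v r = (\<Sum>t<length us. f t * (us ! t) r))"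

lemma spanned_1: "spanned d [u] v \<longleftrightarrow> (\<exists>a. \<forall>r\<in>{1..d}. v r = a * u r)"
  by (auto simp: spanned_def)

lemma spanned_2: "spanned d [u, w] v \<longleftrightarrow> (\<exists>a b. \<forall>r\<in>{1..d}. v r = a * u r + b * w r)" (is "?l \<longleftrightarrow> ?r")
proof
  show "?l \<Longrightarrow> ?r" by (auto simp: spanned_def)
  assume ?r
  then obtain a b where "\<forall>r\<in>{1..d}. v r = a * u r + b * w r" by blast
  then show ?l unfolding spanned_def by (intro exI[of _ "\<lambda>t. if t = 0 then a else b"]) simp
qed

text \<open>The submatrix factors through one dimension less than its size.\<close>

lemma minor_eq_0_if_spanned:
  fixes x :: "nat \<times> 'e::linorder \<Rightarrow> 'k::idom"
  assumes A: "A \<subseteq> {1..d}" "card A = Suc (length us)" and B: "card B = Suc (length us)"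
    and span: "\<And>c. c \<in> B \<Longrightarrow> spanned d us (\<lambda>r. x (r, c))"
  shows "poly_eval x (minor A B) = 0"
proof -
  let ?n = "Suc (length us)"
  define rs where "rs = sorted_list_of_set A"
  define cs where "cs = sorted_list_of_set B"
  have fin: "finite A" "finite B" using A(2) B by (metis card.infinite nat.distinct(1))+
  have rs: "set rs = A" "length rs = ?n" and cs: "set cs = B" "length cs = ?n"
    using fin A(2) B by (simp_all add: rs_def cs_def)
  obtain F where F: "\<And>c r. c \<in> B \<Longrightarrow> r \<in> {1..d} \<Longrightarrow> x (r, c) = (\<Sum>t<length us. F c t * (us ! t) r)"
    using span unfolding spanned_def by metis
  \<comment> \<open>Both factors are padded to square matrices so that the determinant is
    multiplicative. \<open>U\<close> receives a zero last column, which makes \<open>det U\<close>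
    zero and the last row of \<open>C\<close> irrelevant to the product.\<close>
  define U where "U = mat ?n ?n (\<lambda>(i, t). if t < length us then (us ! t) (rs ! i) else 0)"
  define C where "C = mat ?n ?n (\<lambda>(t, j). F (cs ! j) t)"
  have dims: "U \<in> carrier_mat ?n ?n" "C \<in> carrier_mat ?n ?n" by (simp_all add: U_def C_def)
  have "mat ?n ?n (\<lambda>(i, j). x (rs ! i, cs ! j)) = U * C"
  proof (rule eq_matI)
    fix i j assume "i < dim_row (U * C)" "j < dim_col (U * C)"
    then have ij: "i < ?n" "j < ?n" using dims by auto
    then have "rs ! i \<in> A" "cs ! j \<in> B" using rs cs by (metis nth_mem)+
    then have "x (rs ! i, cs ! j) = (\<Sum>t<length us. F (cs ! j) t * (us ! t) (rs ! i))"
      using F A(1) by blast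
    also have "\<dots> = (U * C) $$ (i, j)"
      using ij dims by (simp add: U_def C_def scalar_prod_def atLeast0LessThan mult.commute)
    finally show "mat ?n ?n (\<lambda>(i, j). x (rs ! i, cs ! j)) $$ (i, j) = (U * C) $$ (i, j)"
      using ij by simp
  qed (simp_all add: U_def C_def)
  moreover have "det U = 0"
    using laplace_expansion_column[OF dims(1), of "length us"] by (simp add: U_def)
  ultimately have "list_minor x rs cs = 0"
    unfolding list_minor_def rs(2) using det_mult[OF dims] by simp
  then show ?thesis using poly_eval_minor[of A B x] A(2) B by (simp add: rs_def cs_def)
qed

text \<open>Relative to a nonzero entry, vanishing 2-minors mean proportionality. The guard
  \<open>a \<noteq> c\<close> is there because \<open>{a, c}\<close> otherwise has one element and
  gives no 2-minor.\<close>

lemma spanned_single: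
  fixes x :: "nat \<times> 'e::linorder \<Rightarrow> 'k::field"
  assumes "r0 \<in> {1..d}" "x (r0, a) \<noteq> 0"
    and van: "\<And>A. A \<subseteq> {1..d} \<Longrightarrow> card A = 2 \<Longrightarrow> a \<noteq> c \<Longrightarrow> poly_eval x (minor A {a, c}) = 0"
  shows "spanned d [\<lambda>r. x (r, a)] (\<lambda>r. x (r, c))"
  unfolding spanned_1
proof (intro exI ballI)
  fix r assume r: "r \<in> {1..d}"
  have "x (r0, a) * x (r, c) = x (r, a) * x (r0, c)"
  proof (cases "a = c \<or> r = r0")
    case False
    then have "list_minor x [r0, r] [a, c] = 0"
      using van[of "{r0, r}"] r assms(1) poly_eval_minor_eq_0_iff[of "[r0, r]" "[a, c]" x] by simp
    then show ?thesis by (simp add: list_minor_2)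
  qed auto
  then show "x (r, c) = x (r0, c) / x (r0, a) * x (r, a)"
    using assms(2) by (simp add: field_simps)
qed

text \<open>Cramer's rule: a nonzero 2-minor on the columns \<open>a\<close> and \<open>b\<close>
  allows the coefficients to be written as quotients of 2-minors.\<close>

lemma spanned_pair:
  fixes x :: "nat \<times> 'e::linorder \<Rightarrow> 'k::field"
  assumes "a \<noteq> b" "A \<subseteq> {1..d}" "card A = 2" "poly_eval x (minor A {a, b}) \<noteq> 0"
    and van: "\<And>A. A \<subseteq> {1..d} \<Longrightarrow> card A = 3 \<Longrightarrow> c \<noteq> a \<Longrightarrow> c \<noteq> b \<Longrightarrow>
      poly_eval x (minor A {a, b, c}) = 0"
  shows "spanned d [\<lambda>r. x (r, a), \<lambda>r. x (r, b)] (\<lambda>r. x (r, c))"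
proof -
  obtain r s where rs: "A = {r, s}" "r \<noteq> s" using assms(3) by (auto simp: card_2_iff)
  have D: "list_minor x [r, s] [a, b] \<noteq> 0"
    using poly_eval_minor_eq_0_iff[of "[r, s]" "[a, b]" x] assms rs by simp
  \<comment> \<open>This is the vanishing of the 3-minor on rows \<open>r, s, t\<close>, expanded
    along the row \<open>t\<close>. For \<open>t\<close> in \<open>A\<close> or \<open>c\<close>
    among \<open>a, b\<close> it is an identity, that determinant having two equal rows or
    columns.\<close>
  have eq: "x (t, c) * list_minor x [r, s] [a, b] =
      list_minor x [r, s] [c, b] * x (t, a) + list_minor x [r, s] [a, c] * x (t, b)"
    if t: "t \<in> {1..d}" for t
  proof (cases "t \<in> A \<or> c = a \<or> c = b")
    case True
    then show ?thesis using rs by (auto simp: list_minor_2 algebra_simps)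
  next
    case False
    then have "list_minor x [r, s, t] [a, b, c] = 0"
      using van[of "{r, s, t}"] t rs assms(1,2) poly_eval_minor_eq_0_iff[of "[r, s, t]" "[a, b, c]" x]
      by auto
    then show ?thesis unfolding list_minor_3 list_minor_2 by (simp add: algebra_simps)
  qed
  have "x (t, c) = list_minor x [r, s] [c, b] / list_minor x [r, s] [a, b] * x (t, a) +
      list_minor x [r, s] [a, c] / list_minor x [r, s] [a, b] * x (t, b)" if "t \<in> {1..d}" for t
    using eq[OF that] D by (simp add: field_simps)
  then show ?thesis unfolding spanned_2 by blast
qed

lemma spanned_3: "spanned d [u, w, q] v \<longleftrightarrow> (\<exists>a b c. \<forall>r\<in>{1..d}. v r = a * u r + b * w r + c * q r)" (is "?l \<longleftrightarrow> ?r")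
proof
  show "?l \<Longrightarrow> ?r" by (auto simp: spanned_def numeral_3_eq_3)
  assume ?r
  then obtain a b c where "\<forall>r\<in>{1..d}. v r = a * u r + b * w r + c * q r" by blast
  then show ?l unfolding spanned_def
    by (intro exI[of _ "\<lambda>t. if t = 0 then a else if t = 1 then b else c"]) (simp add: numeral_3_eq_3)
qed

text \<open>The missing coefficient is zero. The cases are those of two lines crossing in a point:
  \<open>u\<close> and \<open>w\<close> span the columns of one line, \<open>q\<close> and one of
  these two the columns of the other.\<close>

lemma spanned_3_subset:
  assumes "spanned d [u, w] v \<or> spanned d [u, q] v \<or> spanned d [w, q] v"
  shows "spanned d [u, w, q] v"
proof -
  have *: "spanned d [u, w, q] v" if "\<forall>r\<in>{1..d}. v r = a * u r + b * w r + c * q r" for a b c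
    using that unfolding spanned_3 by blast
  from assms show ?thesis
  proof (elim disjE)
    assume "spanned d [u, w] v"
    then obtain a b where "\<forall>r\<in>{1..d}. v r = a * u r + b * w r" unfolding spanned_2 by blast
    then show ?thesis using *[of a b 0] by simp
  next
    assume "spanned d [u, q] v"
    then obtain a b where "\<forall>r\<in>{1..d}. v r = a * u r + b * q r" unfolding spanned_2 by blast
    then show ?thesis using *[of a 0 b] by simp
  next
    assume "spanned d [w, q] v"
    then obtain a b where "\<forall>r\<in>{1..d}. v r = a * w r + b * q r" unfolding spanned_2 by blast
    then show ?thesis using *[of 0 a b] by simp
  qed
qed

lemma sorted_list_of_set_nth_mem: "i < card S \<Longrightarrow> sorted_list_of_set S ! i \<in> S"
  by (metis card.infinite length_sorted_list_of_set less_zeroE nth_mem set_sorted_list_of_set)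

lemma poly_eval_minor_cong:
  assumes "card A = card B" "\<And>r c. r \<in> A \<Longrightarrow> c \<in> B \<Longrightarrow> x (r, c) = y (r, c)"
  shows "poly_eval x (minor A B) = poly_eval y (minor A B)"
proof -
  let ?r = "sorted_list_of_set A" and ?c = "sorted_list_of_set B"
  have "x (?r ! i, ?c ! j) = y (?r ! i, ?c ! j)" if "i < card A" "j < card A" for i j
    using that assms(1) by (intro assms(2) sorted_list_of_set_nth_mem) simp_all
  then have "mat (card A) (card A) (\<lambda>(i, j). x (?r ! i, ?c ! j)) =
      mat (card A) (card A) (\<lambda>(i, j). y (?r ! i, ?c ! j))"
    by (intro cong_mat) auto
  then show ?thesis by (simp add: poly_eval_minor[OF assms(1)] list_minor_def)
qed

section \<open>Configuration spaces\<close>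

text \<open>Reduces membership in the configuration space to the generators: each of them is 1 times
  itself in the ideal, and their combinations vanish wherever they do.\<close>

lemma vanishing_locus_ideal_gen: "vanishing_locus V (ideal_gen V F) = vanishing_locus V F"
proof -
  have "F \<subseteq> ideal_gen V F"
  proof
    fix f assume "f \<in> F"
    then have "\<exists>G c. f = (\<Sum>g\<in>G. c g * g) \<and> finite G \<and> G \<subseteq> F \<and> (\<forall>g\<in>G. c g \<in> polys V)"
      by (intro exI[of _ "{f}"] exI[of _ "\<lambda>_. 1"]) (simp add: polys_def)
    then show "f \<in> ideal_gen V F" unfolding ideal_gen_def by blast
  qed
  moreover have "poly_eval x p = 0" if p: "p \<in> ideal_gen V F" "\<forall>f\<in>F. poly_eval x f = 0" for x p
  proof -
    obtain G c where G: "p = (\<Sum>f\<in>G. c f * f)" "G \<subseteq> F"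
      using p(1) by (auto simp: ideal_gen_def)
    have "poly_eval x (c f * f) = 0" if "f \<in> G" for f
      using that G(2) p(2) by (auto simp: poly_eval_mult)
    then show ?thesis unfolding G(1) poly_eval_sum by (simp add: sum.neutral)
  qed
  ultimately show ?thesis unfolding vanishing_locus_def by blast
qed

definition satisfies_arr :: "nat \<Rightarrow> ('e::linorder, 'l) arrangement \<Rightarrow> (nat \<times> 'e \<Rightarrow> 'k::comm_ring_1) \<Rightarrow> bool" where
  "satisfies_arr d L x \<longleftrightarrow>
     (\<forall>r\<in>{1..d}. \<forall>i\<in>zeros L. x (r, i) = 0) \<and>
     (\<forall>A B. A \<subseteq> {1..d} \<and> card A = 2 \<and> card B = 2 \<and> (\<exists>P\<in>blocks L. B \<subseteq> P) \<longrightarrow>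
        poly_eval x (minor A B) = 0) \<and>
     (\<forall>A B. A \<subseteq> {1..d} \<and> card A = 3 \<and> card B = 3 \<and> (\<exists>l\<in>lines L. B \<subseteq> on_line L l) \<longrightarrow>
        poly_eval x (minor A B) = 0) \<and>
     (\<forall>A B. A \<subseteq> {1..d} \<and> card A = 4 \<and> card B = 4 \<and>
        (\<exists>l\<in>lines L. \<exists>m\<in>lines L. l \<noteq> m \<and>
           (\<exists>P\<in>blocks L. (P, l) \<in> inc L \<and> (P, m) \<in> inc L) \<and> B \<subseteq> on_line L l \<union> on_line L m) \<longrightarrow>
        poly_eval x (minor A B) = 0)"

lemma satisfies_arrI:
  assumes "\<And>r i. r \<in> {1..d} \<Longrightarrow> i \<in> zeros L \<Longrightarrow> x (r, i) = 0"
    and "\<And>A B P. A \<subseteq> {1..d} \<Longrightarrow> card A = 2 \<Longrightarrow> card B = 2 \<Longrightarrow> P \<in> blocks L \<Longrightarrow> B \<subseteq> P \<Longrightarrow>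
      poly_eval x (minor A B) = 0"
    and "\<And>A B l. A \<subseteq> {1..d} \<Longrightarrow> card A = 3 \<Longrightarrow> card B = 3 \<Longrightarrow> l \<in> lines L \<Longrightarrow> B \<subseteq> on_line L l \<Longrightarrow>
      poly_eval x (minor A B) = 0"
    and "\<And>A B l m P. A \<subseteq> {1..d} \<Longrightarrow> card A = 4 \<Longrightarrow> card B = 4 \<Longrightarrow> l \<in> lines L \<Longrightarrow> m \<in> lines L \<Longrightarrow>
      l \<noteq> m \<Longrightarrow> P \<in> blocks L \<Longrightarrow> (P, l) \<in> inc L \<Longrightarrow> (P, m) \<in> inc L \<Longrightarrow>
      B \<subseteq> on_line L l \<union> on_line L m \<Longrightarrow> poly_eval x (minor A B) = 0"
  shows "satisfies_arr d L x"
  unfolding satisfies_arr_def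
  by (intro conjI allI impI ballI; (elim conjE bexE)?) (fact assms | rule assms(4); assumption)+

lemma satisfies_arrD:
  assumes "satisfies_arr d L x" "A \<subseteq> {1..d}"
  shows "card A = 2 \<Longrightarrow> card B = 2 \<Longrightarrow> P \<in> blocks L \<Longrightarrow> B \<subseteq> P \<Longrightarrow> poly_eval x (minor A B) = 0"
    and "card A = 3 \<Longrightarrow> card B = 3 \<Longrightarrow> l \<in> lines L \<Longrightarrow> B \<subseteq> on_line L l \<Longrightarrow> poly_eval x (minor A B) = 0"
    and "card A = 4 \<Longrightarrow> card B = 4 \<Longrightarrow> l \<in> lines L \<Longrightarrow> m \<in> lines L \<Longrightarrow>
      l \<noteq> m \<Longrightarrow> P \<in> blocks L \<Longrightarrow> (P, l) \<in> inc L \<Longrightarrow> (P, m) \<in> inc L \<Longrightarrow>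
      B \<subseteq> on_line L l \<union> on_line L m \<Longrightarrow> poly_eval x (minor A B) = 0"
proof -
  note c = assms(1)[unfolded satisfies_arr_def, THEN conjunct2]
  show "card A = 2 \<Longrightarrow> card B = 2 \<Longrightarrow> P \<in> blocks L \<Longrightarrow> B \<subseteq> P \<Longrightarrow> poly_eval x (minor A B) = 0"
    by (rule c[THEN conjunct1, rule_format]) (use assms(2) in blast)
  show "card A = 3 \<Longrightarrow> card B = 3 \<Longrightarrow> l \<in> lines L \<Longrightarrow> B \<subseteq> on_line L l \<Longrightarrow> poly_eval x (minor A B) = 0"
    by (rule c[THEN conjunct2, THEN conjunct1, rule_format]) (use assms(2) in blast)
  show "card A = 4 \<Longrightarrow> card B = 4 \<Longrightarrow> l \<in> lines L \<Longrightarrow> m \<in> lines L \<Longrightarrow>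
      l \<noteq> m \<Longrightarrow> P \<in> blocks L \<Longrightarrow> (P, l) \<in> inc L \<Longrightarrow> (P, m) \<in> inc L \<Longrightarrow>
      B \<subseteq> on_line L l \<union> on_line L m \<Longrightarrow> poly_eval x (minor A B) = 0"
    by (rule c[THEN conjunct2, THEN conjunct2, rule_format]) (use assms(2) in blast)
qed

lemma arr_polys_vanish_iff: "(\<forall>p\<in>arr_polys d L. poly_eval x p = 0) \<longleftrightarrow> satisfies_arr d L x"
proof -
  have minors: "(\<forall>p\<in>{minor A B | A B. R A B}. poly_eval x p = 0) \<longleftrightarrow>
      (\<forall>A B. R A B \<longrightarrow> poly_eval x (minor A B) = 0)" for R
    by auto
  have vars: "(\<forall>p\<in>{Var (i, j) | i j. i \<in> {1..d} \<and> j \<in> zeros L}. poly_eval x p = 0) \<longleftrightarrow>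
      (\<forall>r\<in>{1..d}. \<forall>i\<in>zeros L. x (r, i) = 0)"
    by (force simp: poly_eval_Var)
  show ?thesis
    unfolding arr_polys_def satisfies_arr_def ball_Un minors vars by (simp only: conj_assoc)
qed

lemma config_set_iff:
  "x \<in> config_set d L \<longleftrightarrow> x \<in> affine_space (entries d L) \<and> satisfies_arr d L x \<and>
     (\<forall>B. basis d L B \<longrightarrow> (\<exists>A\<subseteq>{1..d}. card A = card B \<and> poly_eval x (minor A B) \<noteq> 0))"
proof -
  have minors: "(\<forall>p\<in>{minor A B | A. R A}. poly_eval x p = 0) \<longleftrightarrow> (\<forall>A. R A \<longrightarrow> poly_eval x (minor A B) = 0)" for R B
    by auto
  show ?thesis
    unfolding config_set_def arr_ideal_def minors_ideal_def vanishing_locus_ideal_gen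
    unfolding arr_polys_vanish_iff[symmetric] vanishing_locus_def Diff_iff UN_iff Bex_def mem_Collect_eq minors by blast
qed

section \<open>Independent sets and spans in a configuration\<close>

lemma independent_points_extend:
  assumes "finite (ground L)" "independent_points d L C"
  shows "\<exists>B. basis d L B \<and> C \<subseteq> B"
proof -
  have "finite {B. independent_points d L B}"
    by (rule finite_subset[of _ "Pow (ground L)"]) (auto simp: independent_points_def assms(1))
  from finite_has_maximal2[OF this, of C] assms(2)
  obtain B where "independent_points d L B" "C \<subseteq> B" "\<And>D. independent_points d L D \<Longrightarrow> B \<subseteq> D \<Longrightarrow> B = D"
    by auto
  then show ?thesis unfolding basis_def by metis
qed

text \<open>The definition of \<open>config_set\<close> speaks of bases only. Extending
  \<open>C\<close> to a basis and deleting columns from a nonzero minor of it covers all independent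
  sets.\<close>

lemma config_set_independent:
  fixes x :: "nat \<times> 'e::linorder \<Rightarrow> 'k::idom"
  assumes "finite (ground L)" "x \<in> config_set d L" "independent_points d L C"
  shows "\<exists>A\<subseteq>{1..d}. card A = card C \<and> poly_eval x (minor A C) \<noteq> 0"
proof -
  obtain B where B: "basis d L B" "C \<subseteq> B"
    using independent_points_extend[OF assms(1,3)] by blast
  have "\<forall>B. basis d L B \<longrightarrow> (\<exists>A\<subseteq>{1..d}. card A = card B \<and> poly_eval x (minor A B) \<noteq> 0)"
    using assms(2) unfolding config_set_iff by (elim conjE)
  then obtain A where A: "A \<subseteq> {1..d}" "card A = card B" "poly_eval x (minor A B) \<noteq> 0"
    using B(1) by blast
  have "B \<subseteq> ground L" using B(1) by (simp add: basis_def independent_points_def)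
  then have "finite B" using assms(1) by (rule finite_subset)
  from minor_subset[OF this B(2) A(2,3)] show ?thesis using A(1) by blast
qed

context
  fixes d :: nat and L :: "('e::linorder, 'l) arrangement" and x :: "nat \<times> 'e \<Rightarrow> 'k::field"
  assumes d: "d \<ge> 3" and L: "line_arrangement L" and x: "x \<in> config_set d L"
begin

text \<open>A single element outside \<open>zeros L\<close> is independent, and its 1-minors are the
  entries of its column.\<close>

lemma config_set_nonzero:
  assumes "i \<in> ground L - zeros L"
  shows "\<exists>r\<in>{1..d}. x (r, i) \<noteq> 0"
proof -
  have "\<not> (\<exists>T\<subseteq>{i}. card T = 3 \<and> T \<subseteq> on_line L l)" for l
    by (auto simp: subset_singleton_iff)
  then have "independent_points d L {i}"
    using assms d by (auto simp: independent_points_def)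
  from config_set_independent[OF _ x this] obtain A where A: "A \<subseteq> {1..d}" "card A = 1" "poly_eval x (minor A {i}) \<noteq> 0"
    using L by (auto simp: line_arrangement_def)
  then obtain r where "A = {r}" by (auto simp: card_1_singleton_iff)
  moreover have "poly_eval x (minor {r} {i}) = x (r, i)" for r
    by (simp add: poly_eval_minor list_minor_Cons)
  ultimately show ?thesis using A by auto
qed

lemma config_set_block_spanned:
  assumes "P \<in> blocks L" "a \<in> P" "c \<in> P"
  shows "spanned d [\<lambda>r. x (r, a)] (\<lambda>r. x (r, c))"
proof -
  have "\<Union>(blocks L) = ground L - zeros L"
    using L by (simp add: line_arrangement_def partition_on_def)
  then have "a \<in> ground L - zeros L" using assms by blast
  then obtain r where r: "r \<in> {1..d}" "x (r, a) \<noteq> 0" using config_set_nonzero by blast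
  show ?thesis
  proof (rule spanned_single[of r d x a c, OF r])
    fix A assume *: "A \<subseteq> {1..d}" "card A = 2" "a \<noteq> c"
    have "satisfies_arr d L x" using x by (simp add: config_set_iff)
    moreover have "card {a, c} = 2" "{a, c} \<subseteq> P" using * assms by simp_all
    ultimately show "poly_eval x (minor A {a, c}) = 0"
      by (intro satisfies_arrD(1)[OF _ *(1,2) _ assms(1)])
  qed
qed

text \<open>Elements of two different blocks form an independent pair, so some 2-minor of their
  columns is nonzero; the 3-minors of \<open>m\<close> then force every further column into their
  plane.\<close>

lemma config_set_line_spanned:
  assumes m: "m \<in> lines L" and PQ: "P \<in> blocks L" "Q \<in> blocks L" "P \<noteq> Q" "(P, m) \<in> inc L" "(Q, m) \<in> inc L"
    and ab: "a \<in> P" "b \<in> Q" and c: "c \<in> on_line L m"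
  shows "spanned d [\<lambda>r. x (r, a), \<lambda>r. x (r, b)] (\<lambda>r. x (r, c))"
proof -
  have part: "\<Union>(blocks L) = ground L - zeros L" "disjoint (blocks L)"
    using L by (auto simp: line_arrangement_def partition_on_def)
  have uniq: "R = S" if "i \<in> R" "i \<in> S" "R \<in> blocks L" "S \<in> blocks L" for i R S
    using part(2) that by (metis IntI disjointD empty_iff)
  have nab: "\<not> coincide L a b" "a \<noteq> b"
    using uniq PQ ab unfolding coincide_def by metis+
  then have nba: "\<not> coincide L b a" by (auto simp: coincide_def)
  have "card T \<noteq> 3" if "T \<subseteq> {a, b}" for T
    using card_mono[OF _ that] nab(2) by auto
  then have "independent_points d L {a, b}"
    using part(1) ab PQ d nab nba by (auto simp: independent_points_def)
  from config_set_independent[OF _ x this] obtain A where A: "A \<subseteq> {1..d}" "card A = 2" "poly_eval x (minor A {a, b}) \<noteq> 0"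
    using L nab(2) by (auto simp: line_arrangement_def)
  show ?thesis
  proof (rule spanned_pair[OF nab(2) A])
    fix A assume *: "A \<subseteq> {1..d}" "card A = 3" "c \<noteq> a" "c \<noteq> b"
    have "{a, b, c} \<subseteq> on_line L m" using c ab PQ by (auto simp: on_line_def)
    moreover have "card {a, b, c} = 3" using * nab(2) by simp
    moreover have "satisfies_arr d L x" using x by (simp add: config_set_iff)
    ultimately show "poly_eval x (minor A {a, b, c}) = 0"
      by (intro satisfies_arrD(2)[OF _ *(1,2) _ m])
  qed
qed

end

lemma poly_eval_prod: "poly_eval x (\<Prod>i\<in>A. p i) = (\<Prod>i\<in>A. poly_eval x (p i))"
  by (induction A rule: infinite_finite_induct) (simp_all add: poly_eval_mult)

section \<open>Removing a line\<close>

text \<open>\<open>few\<close> uses the incidence of \<open>L\<close> because \<open>l\<close> no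
  longer occurs in \<open>L'\<close>: the intersection of \<open>l\<close> with \<open>L'\<close>
  consists of the surviving blocks on \<open>l\<close>.\<close>

locale line_removal =
  fixes d :: nat and L :: "('e::linorder, 'l) arrangement" and l :: 'l
  assumes d: "d \<ge> 3" and L: "line_arrangement L" and l: "l \<in> lines L"
    and few: "card {P \<in> blocks (remove_line L l). (P, l) \<in> inc L} \<le> 2"
begin

abbreviation "L' \<equiv> remove_line L l"

lemma L': "line_arrangement L'"
  using L by (rule line_arrangement_remove_line)

lemma remove_line_simps:
  "zeros L' = zeros L" "lines L' = lines L - {l}" "blocks L' = {P \<in> blocks L. \<not> solely_on L P l}"
  "ground L' = zeros L \<union> \<Union>(blocks L')" "inc L' = inc L \<inter> blocks L' \<times> (lines L - {l})"
  by (simp_all add: remove_line_def Let_def)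

lemma finite_ground: "finite (ground L)"
  using L by (simp add: line_arrangement_def)

lemma Union_blocks: "\<Union>(blocks L) = ground L - zeros L"
  using L by (simp add: line_arrangement_def partition_on_def)

lemma block_unique: "P \<in> blocks L \<Longrightarrow> Q \<in> blocks L \<Longrightarrow> i \<in> P \<Longrightarrow> i \<in> Q \<Longrightarrow> P = Q"
proof -
  have "disjoint (blocks L)" using L by (simp add: line_arrangement_def partition_on_def)
  then show "P \<in> blocks L \<Longrightarrow> Q \<in> blocks L \<Longrightarrow> i \<in> P \<Longrightarrow> i \<in> Q \<Longrightarrow> P = Q"
    using disjointD[of "blocks L" P Q] by blast
qed

lemma block_nonempty: "P \<in> blocks L \<Longrightarrow> \<exists>i. i \<in> P"
proof -
  have "{} \<notin> blocks L" using L by (simp add: line_arrangement_def partition_on_def)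
  then show "P \<in> blocks L \<Longrightarrow> \<exists>i. i \<in> P" by (metis ex_in_conv)
qed

lemma inc_blocks: "(P, m) \<in> inc L \<Longrightarrow> P \<in> blocks L \<and> m \<in> lines L"
proof -
  have "inc L \<subseteq> blocks L \<times> lines L" using L by (simp add: line_arrangement_def)
  then show "(P, m) \<in> inc L \<Longrightarrow> P \<in> blocks L \<and> m \<in> lines L" by blast
qed

lemma three_blocks: "m \<in> lines L \<Longrightarrow> card {P \<in> blocks L. (P, m) \<in> inc L} \<ge> 3"
  using L by (simp add: line_arrangement_def)

lemma finite_blocks: "finite (blocks L)"
proof -
  have "finite (\<Union>(blocks L))" using finite_ground by (simp add: Union_blocks)
  then show ?thesis by (rule finite_UnionD)
qed

lemma zeros_subset: "zeros L \<subseteq> ground L"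
  using L by (simp add: line_arrangement_def)

lemma ground_subset: "ground L' \<subseteq> ground L"
  using Union_blocks zeros_subset unfolding remove_line_simps by blast

text \<open>Blocks survive or disappear as a whole, being disjoint from each other and from the zero
  points.\<close>

lemma mem_ground_iff:
  assumes "P \<in> blocks L" "i \<in> P"
  shows "i \<in> ground L' \<longleftrightarrow> P \<in> blocks L'"
proof
  have i: "i \<notin> zeros L" using assms Union_blocks by blast
  assume "i \<in> ground L'"
  then obtain Q where Q: "Q \<in> blocks L'" "i \<in> Q" using i unfolding remove_line_simps(4) by blast
  then have "Q \<in> blocks L" by (simp add: remove_line_simps)
  then show "P \<in> blocks L'" using block_unique[OF assms(1) _ assms(2) Q(2)] Q(1) by simp
next
  assume "P \<in> blocks L'"
  then show "i \<in> ground L'" using assms(2) unfolding remove_line_simps(4) by blast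
qed

lemma removed_point:
  assumes "i \<in> ground L" "i \<notin> ground L'"
  shows "\<exists>P\<in>blocks L. i \<in> P \<and> (P, l) \<in> inc L \<and> P \<notin> blocks L'"
proof -
  have "i \<notin> zeros L" using assms by (auto simp: remove_line_simps(4))
  then obtain P where P: "P \<in> blocks L" "i \<in> P" using assms(1) Union_blocks by blast
  then have "P \<notin> blocks L'" using assms(2) mem_ground_iff by blast
  then have "(P, l) \<in> inc L" using P by (simp add: remove_line_simps solely_on_def)
  with P \<open>P \<notin> blocks L'\<close> show ?thesis by blast
qed

text \<open>A block on a second line does not lie solely on \<open>l\<close>; hence lines other than
  \<open>l\<close> lose no points.\<close>

lemma block_remaining: "m \<in> lines L \<Longrightarrow> m \<noteq> l \<Longrightarrow> (P, m) \<in> inc L \<Longrightarrow> P \<in> blocks L' \<and> (P, m) \<in> inc L'"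
  using inc_blocks[of P m] by (auto simp: remove_line_simps solely_on_def)

lemma on_line_remaining:
  assumes "m \<in> lines L" "m \<noteq> l"
  shows "on_line L' m = on_line L m"
proof -
  have "{P \<in> blocks L'. (P, m) \<in> inc L'} = {P \<in> blocks L. (P, m) \<in> inc L}"
    using block_remaining[OF assms] by (auto simp: remove_line_simps)
  then show ?thesis by (simp add: on_line_def)
qed

lemma on_line_subset_ground: "on_line L' m \<subseteq> ground L'"
  by (auto simp: on_line_def remove_line_simps(4))

text \<open>Restoring \<open>l\<close> could destroy independence only through three elements on
  \<open>l\<close>. They would lie in three different surviving blocks of \<open>l\<close>, against
  \<open>few\<close>.\<close>

lemma independent_remaining:
  assumes "independent_points d L' B"
  shows "independent_points d L B"
proof -
  have B: "B \<subseteq> ground L'" "card B \<le> d" "B \<inter> zeros L = {}"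
    "\<And>i j. i \<in> B \<Longrightarrow> j \<in> B \<Longrightarrow> i \<noteq> j \<Longrightarrow> \<not> coincide L' i j"
    "\<And>m T. m \<in> lines L' \<Longrightarrow> T \<subseteq> B \<Longrightarrow> card T = 3 \<Longrightarrow> \<not> T \<subseteq> on_line L' m"
    using assms unfolding independent_points_def by (auto simp: remove_line_simps(1))
  have nc: "\<not> coincide L i j" if ij: "i \<in> B" "j \<in> B" "i \<noteq> j" for i j
  proof
    assume "coincide L i j"
    then obtain P where P: "P \<in> blocks L" "i \<in> P" "j \<in> P" unfolding coincide_def by blast
    then have "P \<in> blocks L'" using B(1) ij(1) mem_ground_iff by blast
    then have "coincide L' i j" using P unfolding coincide_def by blast
    then show False using B(4)[OF ij] by blast
  qed
  have "\<not> T \<subseteq> on_line L m" if T: "m \<in> lines L" "T \<subseteq> B" "card T = 3" for m T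
  proof (cases "m = l")
    case False
    then show ?thesis using B(5)[of m T] T on_line_remaining[of m] by (simp add: remove_line_simps)
  next
    case True
    show ?thesis
    proof
      assume "T \<subseteq> on_line L m"
      then have "\<forall>i\<in>T. \<exists>P. P \<in> blocks L \<and> (P, l) \<in> inc L \<and> i \<in> P"
        using True unfolding on_line_def by blast
      then obtain f where f: "\<And>i. i \<in> T \<Longrightarrow> f i \<in> blocks L \<and> (f i, l) \<in> inc L \<and> i \<in> f i"
        by metis
      have "inj_on f T"
      proof (rule inj_onI, rule ccontr)
        fix i j assume "i \<in> T" "j \<in> T" "f i = f j" "i \<noteq> j"
        then have "coincide L i j" using f[of i] f[of j] unfolding coincide_def by auto
        then show False using nc[of i j] T(2) \<open>i \<in> T\<close> \<open>j \<in> T\<close> \<open>i \<noteq> j\<close> by blast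
      qed
      moreover have "f ` T \<subseteq> {P \<in> blocks L'. (P, l) \<in> inc L}"
        using f mem_ground_iff T(2) B(1) by blast
      moreover have "finite {P \<in> blocks L'. (P, l) \<in> inc L}"
        using finite_blocks by (simp add: remove_line_simps)
      ultimately have "card T \<le> card {P \<in> blocks L'. (P, l) \<in> inc L}"
        by (rule card_inj_on_le)
      then show False using few T(3) by simp
    qed
  qed
  then show ?thesis
    using B nc ground_subset unfolding independent_points_def by blast
qed

text \<open>The at most two surviving blocks on \<open>l\<close> are enlarged to exactly two blocks
  on \<open>l\<close>, which is possible because a line has at least three.\<close>

lemma frame_exists:
  "\<exists>P Q. P \<noteq> Q \<and> (P, l) \<in> inc L \<and> (Q, l) \<in> inc L \<and> {R \<in> blocks L'. (R, l) \<in> inc L} \<subseteq> {P, Q}"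
proof -
  let ?K = "{R \<in> blocks L'. (R, l) \<in> inc L}" and ?S = "{R \<in> blocks L. (R, l) \<in> inc L}"
  have "?K \<subseteq> ?S" by (auto simp: remove_line_simps)
  moreover have "2 \<le> card ?S" using three_blocks[OF l] by simp
  moreover have "finite ?S" using finite_blocks by simp
  ultimately obtain T where T: "?K \<subseteq> T" "T \<subseteq> ?S" "card T = 2"
    using exists_subset_between[OF few, of ?S] by blast
  then obtain P Q where PQ: "T = {P, Q}" "P \<noteq> Q" by (auto simp: card_2_iff)
  then have "(P, l) \<in> inc L" "(Q, l) \<in> inc L" using T(2) by auto
  then show ?thesis
    using PQ T(1) by (intro exI[of _ P] exI[of _ Q]) simp
qed

end

section \<open>Parametrising configurations of \<open>L\<close> over those of
  \<open>L'\<close>\<close>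

datatype 'e param = Free1 nat | Free2 nat | Coeff1 "'e set" | Coeff2 "'e set" | Scale 'e

locale framed_line_removal = line_removal d L l
  for d :: nat and L :: "('e::linorder, 'l) arrangement" and l :: 'l +
  fixes P1 P2 :: "'e set" and e1 e2 :: 'e
  assumes P12: "P1 \<noteq> P2" "(P1, l) \<in> inc L" "(P2, l) \<in> inc L"
    and surviving: "{R \<in> blocks L'. (R, l) \<in> inc L} \<subseteq> {P1, P2}"
    and e12: "e1 \<in> P1" "e2 \<in> P2"
begin

definition block_of :: "'e \<Rightarrow> 'e set" where
  "block_of i = (THE P. P \<in> blocks L \<and> i \<in> P)"

lemma block_of_eq: "P \<in> blocks L \<Longrightarrow> i \<in> P \<Longrightarrow> block_of i = P"
  unfolding block_of_def using block_unique by (intro the_equality) auto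

text \<open>A surviving \<open>e1\<close> already has its column in the base configuration; only
  otherwise can the vector be chosen freely. Together with \<open>dir2\<close> it generates the
  space meant to contain all columns on \<open>l\<close>.\<close>

definition dir1 :: "('e param \<Rightarrow> 'k) \<Rightarrow> (nat \<times> 'e \<Rightarrow> 'k) \<Rightarrow> nat \<Rightarrow> 'k" where
  "dir1 t z r = (if e1 \<in> ground L' then z (r, e1) else t (Free1 r))"

definition dir2 :: "('e param \<Rightarrow> 'k) \<Rightarrow> (nat \<times> 'e \<Rightarrow> 'k) \<Rightarrow> nat \<Rightarrow> 'k" where
  "dir2 t z r = (if e2 \<in> ground L' then z (r, e2) else t (Free2 r))"

text \<open>The vector multiplied by \<open>t (Scale i)\<close> depends on the block of
  \<open>i\<close> alone, so the elements of a removed block receive multiples of a common vector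
  for every \<open>t\<close>. The value \<open>undefined\<close> outside the matrix is the
  normalisation of \<open>affine_space\<close>.\<close>

definition place :: "('e param \<Rightarrow> 'k::field) \<Rightarrow> (nat \<times> 'e \<Rightarrow> 'k) \<Rightarrow> nat \<times> 'e \<Rightarrow> 'k" where
  "place t z = (\<lambda>(r, i).
     if r \<in> {1..d} \<and> i \<in> ground L then
       if i \<in> ground L' then z (r, i)
       else t (Scale i) * (t (Coeff1 (block_of i)) * dir1 t z r + t (Coeff2 (block_of i)) * dir2 t z r)
     else undefined)"

lemma place_remaining: "r \<in> {1..d} \<Longrightarrow> i \<in> ground L' \<Longrightarrow> place t z (r, i) = z (r, i)"
  using ground_subset by (auto simp: place_def)

lemma place_removed:
  assumes "r \<in> {1..d}" "P \<in> blocks L" "i \<in> P" "P \<notin> blocks L'"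
  shows "place t z (r, i) = t (Scale i) * (t (Coeff1 P) * dir1 t z r + t (Coeff2 P) * dir2 t z r)"
proof -
  have "i \<in> ground L" using assms Union_blocks by blast
  moreover have "i \<notin> ground L'" using mem_ground_iff assms by blast
  ultimately show ?thesis using assms block_of_eq by (simp add: place_def)
qed

lemma poly_fun_place: "poly_fun (entries d L') (\<lambda>z. place t z v :: 'k::field)"
proof (cases v)
  case (Pair r i)
  show ?thesis
  proof (cases "r \<in> {1..d} \<and> i \<in> ground L")
    case False
    then show ?thesis unfolding Pair place_def by (auto intro: poly_fun_const)
  next
    case r: True
    have var: "poly_fun (entries d L') (\<lambda>z. z (r, j) :: 'k)" if "j \<in> ground L'" for j
      using that r by (intro poly_fun_var) (simp add: entries_def)
    have dir1: "poly_fun (entries d L') (\<lambda>z. dir1 t z r)"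
      unfolding dir1_def by (cases "e1 \<in> ground L'") (simp_all add: var poly_fun_const)
    have dir2: "poly_fun (entries d L') (\<lambda>z. dir2 t z r)"
      unfolding dir2_def by (cases "e2 \<in> ground L'") (simp_all add: var poly_fun_const)
    note product = poly_fun_mult[OF poly_fun_const[of _ "t (Scale i)"] poly_fun_add[OF
        poly_fun_mult[OF poly_fun_const[of _ "t (Coeff1 (block_of i))"] dir1]
        poly_fun_mult[OF poly_fun_const[of _ "t (Coeff2 (block_of i))"] dir2]]]
    show ?thesis
      unfolding Pair place_def prod.case
      by (cases "i \<in> ground L'") (simp_all only: r if_True if_False var product simp_thms)
  qed
qed

text \<open>Every parameter is affine in \<open>u\<close>, but an entry multiplies up to three
  parameters and is thus a polynomial of degree at most three.\<close>

lemma upoly_fun_place: "upoly_fun (\<lambda>u. place (\<lambda>p. s p + u * (t p - s p)) z v :: 'k::field)"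
proof (cases v)
  case (Pair r i)
  have c: "upoly_fun (\<lambda>u. s p + u * (t p - s p))" for p
    by (rule upoly_fun_affine)
  have dir1: "upoly_fun (\<lambda>u. dir1 (\<lambda>p. s p + u * (t p - s p)) z r)"
    unfolding dir1_def by (cases "e1 \<in> ground L'") (simp_all add: c upoly_fun_const)
  have dir2: "upoly_fun (\<lambda>u. dir2 (\<lambda>p. s p + u * (t p - s p)) z r)"
    unfolding dir2_def by (cases "e2 \<in> ground L'") (simp_all add: c upoly_fun_const)
  note product = upoly_fun_mult[OF c[of "Scale i"] upoly_fun_add[OF
      upoly_fun_mult[OF c[of "Coeff1 (block_of i)"] dir1] upoly_fun_mult[OF c[of "Coeff2 (block_of i)"] dir2]]]
  consider "\<not> (r \<in> {1..d} \<and> i \<in> ground L)" | "r \<in> {1..d} \<and> i \<in> ground L" "i \<in> ground L'"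
    | "r \<in> {1..d} \<and> i \<in> ground L" "i \<notin> ground L'" by blast
  then show ?thesis
    unfolding Pair place_def prod.case
    by cases (simp_all only: if_True if_False upoly_fun_const product simp_thms)
qed

section \<open>The equations of \<open>L\<close> for a placed configuration\<close>

context
  fixes z :: "nat \<times> 'e \<Rightarrow> 'k::field" and t :: "'e param \<Rightarrow> 'k"
  assumes z: "z \<in> config_set d L'"
begin

lemma place_block_spanned:
  assumes P: "P \<in> blocks L'" and ij: "i \<in> P" "j \<in> P"
  shows "spanned d [\<lambda>r. z (r, i)] (\<lambda>r. place t z (r, j))"
proof -
  have "j \<in> ground L'" using P ij by (auto simp: remove_line_simps(4))
  then have "place t z (r, j) = z (r, j)" if "r \<in> {1..d}" for r
    using that by (rule place_remaining[rotated])
  then show ?thesis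
    using config_set_block_spanned[OF d L' z P ij] unfolding spanned_1 by (metis (no_types, lifting))
qed

text \<open>Removed blocks are placed in this span by construction. A surviving block on
  \<open>l\<close> is \<open>P1\<close> or \<open>P2\<close>, and the column of its
  \<open>e1\<close> or \<open>e2\<close> is then \<open>dir1\<close> or \<open>dir2\<close>.\<close>

lemma place_line_spanned:
  assumes "c \<in> on_line L l"
  shows "spanned d [dir1 t z, dir2 t z] (\<lambda>r. place t z (r, c))"
proof -
  obtain P where P: "P \<in> blocks L" "(P, l) \<in> inc L" "c \<in> P"
    using assms unfolding on_line_def by blast
  show ?thesis
  proof (cases "P \<in> blocks L'")
    case False
    have "place t z (r, c) = (t (Scale c) * t (Coeff1 P)) * dir1 t z r + (t (Scale c) * t (Coeff2 P)) * dir2 t z r"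
      if "r \<in> {1..d}" for r
      using place_removed[OF that P(1,3) False, of t z] by (simp add: algebra_simps)
    then show ?thesis unfolding spanned_2 by blast
  next
    case True
    then have "P = P1 \<or> P = P2" using surviving P(2) by blast
    then show ?thesis
    proof
      assume "P = P1"
      then have e: "e1 \<in> P" using e12 by simp
      then have "e1 \<in> ground L'" using True by (auto simp: remove_line_simps(4))
      then have "dir1 t z = (\<lambda>r. z (r, e1))" by (simp add: dir1_def fun_eq_iff)
      then obtain a where "\<forall>r\<in>{1..d}. place t z (r, c) = a * dir1 t z r + 0 * dir2 t z r"
        using place_block_spanned[OF True e P(3)] unfolding spanned_1 by auto
      then show ?thesis unfolding spanned_2 by blast
    next
      assume "P = P2"
      then have e: "e2 \<in> P" using e12 by simp
      then have "e2 \<in> ground L'" using True by (auto simp: remove_line_simps(4))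
      then have "dir2 t z = (\<lambda>r. z (r, e2))" by (simp add: dir2_def fun_eq_iff)
      then obtain a where "\<forall>r\<in>{1..d}. place t z (r, c) = 0 * dir1 t z r + a * dir2 t z r"
        using place_block_spanned[OF True e P(3)] unfolding spanned_1 by auto
      then show ?thesis unfolding spanned_2 by blast
    qed
  qed
qed

text \<open>All points of \<open>m\<close> survive, so their columns come from \<open>z\<close>. The
  first spanning vector can be prescribed by any \<open>e\<close> in \<open>R\<close>; the second
  comes from another block on \<open>m\<close>. At a crossing with \<open>l\<close> this
  prescription provides a vector shared with the span of \<open>l\<close>.\<close>

lemma place_other_line_spanned:
  assumes m: "m \<in> lines L" "m \<noteq> l" and R: "(R, m) \<in> inc L" "e \<in> R" 
  shows "\<exists>q. \<forall>c\<in>on_line L m. spanned d [\<lambda>r. z (r, e), q] (\<lambda>r. place t z (r, c))"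
proof -
  have "\<exists>Q. (Q, m) \<in> inc L \<and> Q \<noteq> R"
  proof (rule ccontr)
    assume "\<not> ?thesis"
    then have "{P \<in> blocks L. (P, m) \<in> inc L} \<subseteq> {R}" by auto
    from card_mono[OF _ this] show False using three_blocks[OF m(1)] by simp
  qed
  then obtain Q where Q: "(Q, m) \<in> inc L" "Q \<noteq> R" by blast
  have R': "R \<in> blocks L'" "(R, m) \<in> inc L'" and Q': "Q \<in> blocks L'" "(Q, m) \<in> inc L'"
    using block_remaining[OF m] R Q by blast+
  have "Q \<in> blocks L" using Q' by (simp add: remove_line_simps)
  then obtain b where b: "b \<in> Q" using block_nonempty by blast
  have m': "m \<in> lines L'" using m by (simp add: remove_line_simps)
  have "spanned d [\<lambda>r. z (r, e), \<lambda>r. z (r, b)] (\<lambda>r. place t z (r, c))" if "c \<in> on_line L m" for c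
  proof -
    have c: "c \<in> on_line L' m" using that on_line_remaining[OF m] by simp
    then have "place t z (r, c) = z (r, c)" if "r \<in> {1..d}" for r
      using that on_line_subset_ground by (intro place_remaining) auto
    then show ?thesis
      using config_set_line_spanned[OF d L' z m' R'(1) Q'(1) _ R'(2) Q'(2) R(2) b c] Q(2)
      unfolding spanned_2 by (metis (no_types, lifting))
  qed
  then show ?thesis by blast
qed

text \<open>The crossing point \<open>R\<close> lies on \<open>m\<close>, hence survives, hence is
  \<open>P1\<close> or \<open>P2\<close>. So \<open>dir1\<close> or \<open>dir2\<close> belongs to
  the spans of both lines, and three vectors suffice for all four columns.\<close>

lemma place_two_lines:
  assumes A: "A \<subseteq> {1..d}" "card A = 4" and B: "card B = 4" "B \<subseteq> on_line L l \<union> on_line L m"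
    and m: "m \<in> lines L" "m \<noteq> l" and R: "(R, l) \<in> inc L" "(R, m) \<in> inc L"
  shows "poly_eval (place t z) (minor A B) = 0"
proof -
  have "R \<in> blocks L'" using block_remaining[OF m R(2)] by blast
  then have R': "R \<in> blocks L'" "R = P1 \<or> R = P2" using surviving R(1) by auto
  have span: "\<exists>q. \<forall>c\<in>B. spanned d [dir1 t z, dir2 t z, q] (\<lambda>r. place t z (r, c))"
    using R'(2)
  proof
    assume "R = P1"
    then have e: "e1 \<in> R" using e12 by simp
    then have "e1 \<in> ground L'" using R' by (auto simp: remove_line_simps(4))
    then have "dir1 t z = (\<lambda>r. z (r, e1))" by (simp add: dir1_def fun_eq_iff)
    then obtain q where "\<forall>c\<in>on_line L m. spanned d [dir1 t z, q] (\<lambda>r. place t z (r, c))"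
      using place_other_line_spanned[OF m R(2) e] by auto
    then show ?thesis using B(2) place_line_spanned by (intro exI[of _ q] ballI spanned_3_subset) blast
  next
    assume "R = P2"
    then have e: "e2 \<in> R" using e12 by simp
    then have "e2 \<in> ground L'" using R' by (auto simp: remove_line_simps(4))
    then have "dir2 t z = (\<lambda>r. z (r, e2))" by (simp add: dir2_def fun_eq_iff)
    then obtain q where "\<forall>c\<in>on_line L m. spanned d [dir2 t z, q] (\<lambda>r. place t z (r, c))"
      using place_other_line_spanned[OF m R(2) e] by auto
    then show ?thesis using B(2) place_line_spanned by (intro exI[of _ q] ballI spanned_3_subset) blast
  qed
  then obtain q where "\<And>c. c \<in> B \<Longrightarrow> spanned d [dir1 t z, dir2 t z, q] (\<lambda>r. place t z (r, c))"
    by blast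
  then show ?thesis
    using A B by (intro minor_eq_0_if_spanned[of A d "[dir1 t z, dir2 t z, q]"]) simp_all
qed

text \<open>Equations among surviving columns are inherited from \<open>z\<close>. The others
  concern a removed block or the line \<open>l\<close> and hold for dimension reasons, whatever
  \<open>t\<close> is.\<close>

lemma place_satisfies: "satisfies_arr d L (place t z)"
proof -
  have sat: "satisfies_arr d L' z" using z by (simp add: config_set_iff)
  have rem: "poly_eval (place t z) (minor A B) = poly_eval z (minor A B)"
    if "A \<subseteq> {1..d}" "card A = card B" "B \<subseteq> ground L'" for A B
    using that by (intro poly_eval_minor_cong place_remaining) auto
  show ?thesis
  proof (rule satisfies_arrI)
    fix r i assume r: "r \<in> {1..d}" "i \<in> zeros L"
    then have "i \<in> ground L'" by (simp add: remove_line_simps(4))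
    moreover have "z (r, i) = 0"
      using sat r unfolding satisfies_arr_def remove_line_simps(1) by simp
    ultimately show "place t z (r, i) = 0" using r by (simp only: place_remaining)
  next
    fix A B P assume A: "A \<subseteq> {1..d}" "card A = 2" "card B = 2" and P: "P \<in> blocks L" "B \<subseteq> P"
    show "poly_eval (place t z) (minor A B) = 0"
    proof (cases "P \<in> blocks L'")
      case True
      then have "B \<subseteq> ground L'" using P(2) unfolding remove_line_simps(4) by blast
      then show ?thesis using rem[of A B] satisfies_arrD(1)[OF sat A True P(2)] A by simp
    next
      case False
      have "spanned d [\<lambda>r. t (Coeff1 P) * dir1 t z r + t (Coeff2 P) * dir2 t z r] (\<lambda>r. place t z (r, c))"
        if "c \<in> B" for c
        using place_removed[OF _ P(1) _ False, of _ c t z] that P(2) unfolding spanned_1 by blast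
      then show ?thesis
        using A
        by (intro minor_eq_0_if_spanned[of A d "[\<lambda>r. t (Coeff1 P) * dir1 t z r + t (Coeff2 P) * dir2 t z r]"]) simp_all
    qed
  next
    fix A B m assume A: "A \<subseteq> {1..d}" "card A = 3" "card B = 3" and m: "m \<in> lines L" "B \<subseteq> on_line L m"
    show "poly_eval (place t z) (minor A B) = 0"
    proof (cases "m = l")
      case False
      then have B: "B \<subseteq> on_line L' m" "m \<in> lines L'"
        using m on_line_remaining[OF m(1) False] by (simp_all add: remove_line_simps)
      then have "B \<subseteq> ground L'" using on_line_subset_ground by blast
      then show ?thesis using rem[of A B] satisfies_arrD(2)[OF sat A B(2,1)] A by simp
    next
      case True
      then have "spanned d [dir1 t z, dir2 t z] (\<lambda>r. place t z (r, c))" if "c \<in> B" for c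
        using place_line_spanned m(2) that by blast
      then show ?thesis using A by (intro minor_eq_0_if_spanned[of A d "[dir1 t z, dir2 t z]"]) simp_all
    qed
  next
    fix A B k m P
    assume A: "A \<subseteq> {1..d}" "card A = 4" "card B = 4" and km: "k \<in> lines L" "m \<in> lines L" "k \<noteq> m"
      and P: "P \<in> blocks L" "(P, k) \<in> inc L" "(P, m) \<in> inc L" and B: "B \<subseteq> on_line L k \<union> on_line L m"
    \<comment> \<open>Either of the two crossing lines may be \<open>l\<close>, and the argument is
      symmetric in them; if neither is, all columns survive.\<close>
    consider "k = l" | "m = l" | "k \<noteq> l" "m \<noteq> l" by blast
    then show "poly_eval (place t z) (minor A B) = 0"
    proof cases
      case 1
      then show ?thesis using place_two_lines[OF A _ km(2) _ _ P(3)] B P(2) km(3) by simp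
    next
      case 2
      then show ?thesis using place_two_lines[OF A _ km(1) _ _ P(2)] B P(3) km(3) by (simp add: Un_commute)
    next
      case 3
      have B': "B \<subseteq> on_line L' k \<union> on_line L' m"
        using B on_line_remaining[OF km(1) 3(1)] on_line_remaining[OF km(2) 3(2)] by simp
      then have "B \<subseteq> ground L'" using on_line_subset_ground by blast
      moreover have "P \<in> blocks L'" "(P, k) \<in> inc L'" "(P, m) \<in> inc L'"
        using block_remaining[OF km(1) 3(1) P(2)] block_remaining[OF km(2) 3(2) P(3)] by blast+
      moreover have "k \<in> lines L'" "m \<in> lines L'" using km 3 by (simp_all add: remove_line_simps)
      ultimately show ?thesis
        using rem[of A B] satisfies_arrD(3)[OF sat A _ _ km(3) _ _ _ B'] A by simp
    qed
  qed
qed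

end

text \<open>Each basis has a minor that is nonzero at \<open>x\<close>; fix one for each. The
  product over the finitely many bases serves as \<open>h\<close>: where it is nonzero, every basis
  is non-degenerate.\<close>

lemma place_into:
  fixes x :: "nat \<times> 'e \<Rightarrow> 'k::field"
  assumes x: "x \<in> config_set d L"
  shows "\<exists>h. poly_eval x h \<noteq> 0 \<and>
    (\<forall>t. \<forall>z\<in>config_set d L'. poly_eval (place t z) h \<noteq> 0 \<longrightarrow> place t z \<in> config_set d L)"
proof -
  let ?B = "{B. basis d L B}"
  have fin: "finite ?B"
    by (rule finite_subset[of _ "Pow (ground L)"])
      (auto simp: basis_def independent_points_def finite_ground)
  have "\<forall>B\<in>?B. \<exists>A. A \<subseteq> {1..d} \<and> card A = card B \<and> poly_eval x (minor A B) \<noteq> 0"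
    using x unfolding config_set_iff by blast
  then obtain A where A: "\<And>B. basis d L B \<Longrightarrow> A B \<subseteq> {1..d}" "\<And>B. basis d L B \<Longrightarrow> card (A B) = card B"
    "\<And>B. basis d L B \<Longrightarrow> poly_eval x (minor (A B) B) \<noteq> 0"
    by (metis mem_Collect_eq)
  let ?h = "\<Prod>B\<in>?B. minor (A B) B :: (nat \<times> 'e, 'k) mpoly"
  have nz: "poly_eval y ?h \<noteq> 0 \<longleftrightarrow> (\<forall>B. basis d L B \<longrightarrow> poly_eval y (minor (A B) B) \<noteq> 0)" for y
    using fin by (simp add: poly_eval_prod)
  have "place t z \<in> config_set d L" if "z \<in> config_set d L'" "poly_eval (place t z) ?h \<noteq> 0" for t z
    unfolding config_set_iff
  proof (intro conjI allI impI)
    show "place t z \<in> affine_space (entries d L)"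
      by (auto simp: affine_space_def entries_def place_def split: if_splits)
    show "satisfies_arr d L (place t z)" using that(1) by (rule place_satisfies)
    show "\<exists>A\<subseteq>{1..d}. card A = card B \<and> poly_eval (place t z) (minor A B) \<noteq> 0" if "basis d L B" for B
      using A(1,2)[OF that] nz \<open>poly_eval (place t z) ?h \<noteq> 0\<close> that by blast
  qed
  moreover have "poly_eval x ?h \<noteq> 0" unfolding nz using A(3) by blast
  ultimately show ?thesis by blast
qed

text \<open>A basis of \<open>L'\<close> need not be maximal in \<open>L\<close>. Its non-degeneracy
  follows because it is still independent in \<open>L\<close>.\<close>

lemma restrict_config_set:
  fixes x :: "nat \<times> 'e \<Rightarrow> 'k::field"
  assumes x: "x \<in> config_set d L"
  shows "restrict x (entries d L') \<in> config_set d L'"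
proof -
  let ?z = "restrict x (entries d L')"
  have sat: "satisfies_arr d L x" using x by (simp add: config_set_iff)
  have rem: "poly_eval ?z (minor A B) = poly_eval x (minor A B)"
    if "A \<subseteq> {1..d}" "card A = card B" "B \<subseteq> ground L'" for A B
    using that by (intro poly_eval_minor_cong) (auto simp: entries_def)
  show ?thesis
    unfolding config_set_iff
  proof (intro conjI allI impI)
    show "?z \<in> affine_space (entries d L')" by (auto simp: affine_space_def)
    show "satisfies_arr d L' ?z"
    proof (rule satisfies_arrI)
      fix r i assume r: "r \<in> {1..d}" "i \<in> zeros L'"
      then have "x (r, i) = 0" using sat unfolding satisfies_arr_def remove_line_simps(1) by simp
      moreover have "(r, i) \<in> entries d L'" using r by (simp add: entries_def remove_line_simps)
      ultimately show "?z (r, i) = 0" by simp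
    next
      fix A B P assume A: "A \<subseteq> {1..d}" "card A = 2" "card B = 2" and P: "P \<in> blocks L'" "B \<subseteq> P"
      then have "B \<subseteq> ground L'" unfolding remove_line_simps(4) by blast
      moreover have "P \<in> blocks L" using P by (simp add: remove_line_simps)
      ultimately show "poly_eval ?z (minor A B) = 0"
        using rem[of A B] satisfies_arrD(1)[OF sat A _ P(2)] A by simp
    next
      fix A B m assume A: "A \<subseteq> {1..d}" "card A = 3" "card B = 3" and m: "m \<in> lines L'" "B \<subseteq> on_line L' m"
      have m': "m \<in> lines L" "m \<noteq> l" using m by (simp_all add: remove_line_simps)
      have "B \<subseteq> ground L'" using m(2) on_line_subset_ground by blast
      then show "poly_eval ?z (minor A B) = 0"
        using rem[of A B] satisfies_arrD(2)[OF sat A m'(1)] m(2) on_line_remaining[OF m'] A by simp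
    next
      fix A B k m P
      assume A: "A \<subseteq> {1..d}" "card A = 4" "card B = 4" and km: "k \<in> lines L'" "m \<in> lines L'" "k \<noteq> m"
        and P: "P \<in> blocks L'" "(P, k) \<in> inc L'" "(P, m) \<in> inc L'" and B: "B \<subseteq> on_line L' k \<union> on_line L' m"
      have k': "k \<in> lines L" "k \<noteq> l" and m': "m \<in> lines L" "m \<noteq> l"
        using km by (simp_all add: remove_line_simps)
      have "B \<subseteq> ground L'" using B on_line_subset_ground by blast
      moreover have "P \<in> blocks L" "(P, k) \<in> inc L" "(P, m) \<in> inc L"
        using P by (simp_all add: remove_line_simps)
      moreover have "B \<subseteq> on_line L k \<union> on_line L m"
        using B on_line_remaining[OF k'] on_line_remaining[OF m'] by simp
      ultimately show "poly_eval ?z (minor A B) = 0"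
        using rem[of A B] satisfies_arrD(3)[OF sat A k'(1) m'(1) km(3)] A by simp
    qed
    fix B assume "basis d L' B"
    then have B: "independent_points d L' B" by (simp add: basis_def)
    then have "B \<subseteq> ground L'" by (simp add: independent_points_def)
    moreover obtain A where "A \<subseteq> {1..d}" "card A = card B" "poly_eval x (minor A B) \<noteq> 0"
      using config_set_independent[OF finite_ground x independent_remaining[OF B]] by blast
    ultimately show "\<exists>A\<subseteq>{1..d}. card A = card B \<and> poly_eval ?z (minor A B) \<noteq> 0"
      using rem[of A B] by auto
  qed
qed

lemma place_onto:
  fixes x :: "nat \<times> 'e \<Rightarrow> 'k::field"
  assumes x: "x \<in> config_set d L"
  shows "\<exists>t. \<exists>z\<in>config_set d L'. x = place t z"
proof -
  define z where "z = restrict x (entries d L')"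
  \<comment> \<open>The two coefficients belong to a block, so they are read off from one
    representative; the scalars \<open>\<gamma>\<close> then carry its column to the other elements
    of the block.\<close>
  define rep where "rep P = (SOME i. i \<in> P)" for P :: "'e set"
  have rep: "rep P \<in> P" if "P \<in> blocks L" for P
    unfolding rep_def using block_nonempty[OF that] by (rule someI_ex)
  have b12: "P1 \<in> blocks L" "P2 \<in> blocks L" using P12 inc_blocks by blast+
  have "\<exists>a b. \<forall>r\<in>{1..d}. x (r, rep P) = a * x (r, e1) + b * x (r, e2)" if P: "(P, l) \<in> inc L" for P
  proof -
    have "P \<in> blocks L" using P inc_blocks by blast
    then have "rep P \<in> on_line L l" using P rep unfolding on_line_def by blast
    from config_set_line_spanned[OF d L x l b12 P12 e12 this] show ?thesis
      unfolding spanned_2 .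
  qed
  then obtain \<alpha> \<beta> where \<alpha>\<beta>:
    "\<And>P r. (P, l) \<in> inc L \<Longrightarrow> r \<in> {1..d} \<Longrightarrow> x (r, rep P) = \<alpha> P * x (r, e1) + \<beta> P * x (r, e2)"
    by metis
  have "\<exists>c. \<forall>r\<in>{1..d}. x (r, i) = c * x (r, rep (block_of i))" if i: "i \<in> \<Union>(blocks L)" for i
  proof -
    from i obtain P where P: "P \<in> blocks L" "i \<in> P" by blast
    show ?thesis
      using config_set_block_spanned[OF d L x P(1) rep[OF P(1)] P(2)]
      unfolding spanned_1 block_of_eq[OF P] .
  qed
  then obtain \<gamma> where \<gamma>: "\<And>i r. i \<in> \<Union>(blocks L) \<Longrightarrow> r \<in> {1..d} \<Longrightarrow>
      x (r, i) = \<gamma> i * x (r, rep (block_of i))"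
    by metis
  \<comment> \<open>\<open>Free1\<close> and \<open>Free2\<close> repeat the columns of
    \<open>e1\<close> and \<open>e2\<close> in \<open>x\<close>, so \<open>dir1\<close> and
    \<open>dir2\<close> equal these columns whether or not the elements survive.\<close>
  define t where "t p = (case p of Free1 r \<Rightarrow> x (r, e1) | Free2 r \<Rightarrow> x (r, e2)
    | Coeff1 P \<Rightarrow> \<alpha> P | Coeff2 P \<Rightarrow> \<beta> P | Scale i \<Rightarrow> \<gamma> i)" for p
  have dir: "dir1 t z r = x (r, e1)" "dir2 t z r = x (r, e2)" if "r \<in> {1..d}" for r
    using that by (simp_all add: dir1_def dir2_def t_def z_def entries_def)
  have "x (r, i) = place t z (r, i)" for r i
  proof -
    consider "\<not> (r \<in> {1..d} \<and> i \<in> ground L)" | "r \<in> {1..d}" "i \<in> ground L'"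
      | "r \<in> {1..d}" "i \<in> ground L" "i \<notin> ground L'" by blast
    then show ?thesis
    proof cases
      case 1
      have "x \<in> affine_space (entries d L)" using x by (simp add: config_set_iff)
      moreover have "(r, i) \<notin> entries d L" using 1 by (simp add: entries_def)
      ultimately have "x (r, i) = undefined" unfolding affine_space_def by (rule PiE_arb)
      moreover have "place t z (r, i) = undefined" using 1 unfolding place_def by (simp only: prod.case if_False)
      ultimately show ?thesis by simp
    next
      case 2
      then show ?thesis by (simp add: place_remaining z_def entries_def)
    next
      case 3
      from removed_point[OF 3(2,3)]
      obtain P where P: "P \<in> blocks L" "i \<in> P" "(P, l) \<in> inc L" "P \<notin> blocks L'" by blast
      have "x (r, i) = \<gamma> i * (\<alpha> P * x (r, e1) + \<beta> P * x (r, e2))"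
        using \<gamma>[OF UnionI[OF P(1,2)] 3(1)] \<alpha>\<beta>[OF P(3) 3(1)] block_of_eq[OF P(1,2)] by simp
      then show ?thesis
        using place_removed[OF 3(1) P(1,2,4), of t z] dir[OF 3(1)] by (simp add: t_def)
    qed
  qed
  then have "x = place t z" by auto
  moreover have "z \<in> config_set d L'" unfolding z_def using x by (rule restrict_config_set)
  ultimately show ?thesis by blast
qed

lemma irreducible_config_space:
  assumes "irreducible_space (config_space d L' :: (nat \<times> 'e \<Rightarrow> 'k::alg_closed_field) topology)"
  shows "irreducible_space (config_space d L :: (nat \<times> 'e \<Rightarrow> 'k) topology)"
  unfolding config_space_def
proof (rule irreducible_parametrised[where \<phi> = place])
  show "irreducible_space (subtopology (zariski (entries d L'))
      (config_set d L' :: (nat \<times> 'e \<Rightarrow> 'k) set))"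
    using assms by (simp add: config_space_def)
qed (auto simp: config_set_iff[THEN iffD1] poly_fun_place upoly_fun_place place_onto place_into)

end

theorem theorem2:
  fixes L :: "('e::linorder, 'l) arrangement" and l :: 'l and d :: nat
  assumes "d \<ge> 3"
    and "line_arrangement L"
    and "l \<in> lines L"
    and "card {P \<in> blocks (remove_line L l). (P, l) \<in> inc L} \<le> 2"
    and "irreducible_space
           (config_space d (remove_line L l) :: (nat \<times> 'e \<Rightarrow> 'k::alg_closed_field) topology)"
  shows "irreducible_space (config_space d L :: (nat \<times> 'e \<Rightarrow> 'k) topology)"
proof -
  interpret line_removal d L l
    using assms(1-4) by (rule line_removal.intro)
  \<comment> \<open>Two points on \<open>l\<close> with representatives are the data over which the
    parametrisation is defined.\<close>
  from frame_exists obtain P1 P2 where P: "P1 \<noteq> P2" "(P1, l) \<in> inc L" "(P2, l) \<in> inc L"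
    "{R \<in> blocks L'. (R, l) \<in> inc L} \<subseteq> {P1, P2}"
    by (elim exE conjE)
  obtain e1 where e1: "e1 \<in> P1" using block_nonempty inc_blocks[OF P(2)] by blast
  obtain e2 where e2: "e2 \<in> P2" using block_nonempty inc_blocks[OF P(3)] by blast
  interpret framed_line_removal d L l P1 P2 e1 e2
    by (intro framed_line_removal.intro line_removal_axioms framed_line_removal_axioms.intro P e1 e2)
  show ?thesis
    using assms(5) by (rule irreducible_config_space)
qed

end
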